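(* Let $T_1>0$, $T_0\in[0,T_1)$, $\alpha\in(\tfrac12,1)$, $\beta\in(0,\alpha)$, and let $x:[0,T_1]\to\mathbb R^d$ be Lipschitz. Let $(T_0,w_{\cdot\wedge T_0})\in\Lambda^{\alpha}_\beta([0,T_1],\mathbb R^m)$ be an initial condition and let $f:\Lambda^\alpha_\beta([0,T_1],\mathbb R^m)\to L(\mathbb R^d,\mathbb R^m)$ be a continuous (non-anticipative) functional. Assume: (i) for every compact $K\subset \mathcal C^{\alpha}_\beta([0,T_1],\mathbb R^m)$ there is $L_K>0$ such that $$|f(t,u_{\cdot\wedge t})-f(t,v_{\cdot\wedge t})|\le L_K\big(|u_0-v_0|+\|u_{\cdot\wedge t}-v_{\cdot\wedge t}\|_{\beta;[0,T_1]}\big)\quad\text{for all }t\in[0,T_1],\ u,v\in K;$$ (ii) there is $C_f>0$ such that $$|f(t,u_{\cdot\wedge t})|\le C_f\big(1+|u_0|+\|u_{\cdot\wedge t}\|_{\beta;[0,T_1]}\big)\quad\text{for all }(t,u_{\cdot\wedge t})\in\Lambda^\alpha_\beta([0,T_1],\mathbb R^m).$$ Then the path-dependent controlled differential equation $$y_t=w_t\ \ (t\in[0,T_0]),\qquad y_t=w_{T_0}+\int_{T_0}^t f(s,y_{\cdot\wedge s})\,\mathrm dx_s\ \ (t\in[T_0,T_1])$$ admits a unique global solution, i.e. a unique solution on $[0,T_1]$.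
   Context: For $\gamma\in(0,1]$, $\mathcal C^\gamma([0,T],\mathbb R^m)$ denotes the space of $\gamma$-H\"older continuous paths $y:[0,T]\to\mathbb R^m$, with seminorm $\|y\|_{\gamma;[0,T]}=\sup_{0\le s<t\le T}|y_t-y_s|/|t-s|^\gamma$ and norm $|y_0|+\|y\|_{\gamma;[0,T]}$ ($\gamma=1$ means Lipschitz). For $\beta<\alpha$, $\mathcal C^\alpha_\beta([0,T],\mathbb R^m)$ is the set $\mathcal C^\alpha([0,T],\mathbb R^m)$ equipped with the topology of the norm $|y_0|+\|y\|_{\beta;[0,T]}$. For $t\in[0,T]$, $y_{\cdot\wedge t}$ is the path stopped at $t$: $y_{u\wedge t}=y_u$ for $u\le t$ and $=y_t$ for $u>t$. The space of stopped paths is $\Lambda^\alpha_\beta([0,T],\mathbb R^m)=\{(t,y_{\cdot\wedge t}):t\in[0,T],\ y\in\mathcal C^\alpha([0,T],\mathbb R^m)\}$ with metric $d^\Lambda_\beta((t,y_{\cdot\wedge t}),(s,z_{\cdot\wedge s}))=|t-s|+|y_0-z_0|+\|y_{\cdot\wedge t}-z_{\cdot\wedge s}\|_{\beta;[0,T]}$. A non-anticipative functional is a map defined on $\Lambda^\alpha_\beta$. $L(\mathbb R^d,\mathbb R^m)$ is the space of linear maps; $\int f\,\mathrm dx=\sum_{j=1}^d\int f^j\,\mathrm dx^j$ ($f^j$ the $j$-th column) is a Riemann–Stieltjes integral. A solution on an interval $[0,T']$ is a path in $\mathcal C^\alpha([0,T'],\mathbb R^m)$ satisfying the equation for all $t\in[0,T']$.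 *)

theory Defs
  imports "HOL-Analysis.Analysis"
begin

section \<open>Hoelder spaces\<close>

text \<open>
  A path on \<open>[0,T]\<close> is a function that is \<open>extensional\<close> on \<open>{0..T}\<close> (it takes the value
  \<open>undefined\<close> elsewhere), so that equality of functions is equality of paths on \<open>[0,T]\<close>.
\<close>

definition holder_quotients :: "real \<Rightarrow> real \<Rightarrow> (real \<Rightarrow> 'a::real_normed_vector) \<Rightarrow> real set" where
  "holder_quotients \<gamma> T y = {norm (y t - y s) / \<bar>t - s\<bar> powr \<gamma> | s t. 0 \<le> s \<and> s < t \<and> t \<le> T}"

definition holder_space :: "real \<Rightarrow> real \<Rightarrow> (real \<Rightarrow> 'a::real_normed_vector) set" where
  "holder_space \<gamma> T = {y \<in> extensional {0..T}. bdd_above (holder_quotients \<gamma> T y)}"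

text \<open>
  The value \<open>0\<close> for functions that are not Hoelder continuous is a totality convention. It makes
  the distances below nonnegative on the whole type, which the locale \<open>Metric_space\<close> requires,
  and is never used for elements of the spaces concerned.
\<close>

definition holder_seminorm :: "real \<Rightarrow> real \<Rightarrow> (real \<Rightarrow> 'a::real_normed_vector) \<Rightarrow> real" where
  "holder_seminorm \<gamma> T y =
     (if bdd_above (holder_quotients \<gamma> T y) then Sup (holder_quotients \<gamma> T y) else 0)"

definition holder_norm :: "real \<Rightarrow> real \<Rightarrow> (real \<Rightarrow> 'a::real_normed_vector) \<Rightarrow> real" where
  "holder_norm \<gamma> T y = norm (y 0) + holder_seminorm \<gamma> T y"

definition holder_dist ::
    "real \<Rightarrow> real \<Rightarrow> (real \<Rightarrow> 'a::real_normed_vector) \<Rightarrow> (real \<Rightarrow> 'a) \<Rightarrow> real" where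
  "holder_dist \<gamma> T y z = holder_norm \<gamma> T (\<lambda>t. y t - z t)"

text \<open>The space \<open>C\<^sup>\<alpha>\<^sub>\<beta>([0,T])\<close>: \<open>\<alpha>\<close>-Hoelder paths with the topology of the \<open>\<beta>\<close>-Hoelder norm.\<close>

definition holder_topology ::
    "real \<Rightarrow> real \<Rightarrow> real \<Rightarrow> (real \<Rightarrow> 'a::real_normed_vector) topology" where
  "holder_topology \<alpha> \<beta> T = Metric_space.mtopology (holder_space \<alpha> T) (holder_dist \<beta> T)"


section \<open>Stopped paths\<close>

definition stopped :: "real \<Rightarrow> real \<Rightarrow> (real \<Rightarrow> 'a) \<Rightarrow> real \<Rightarrow> 'a" where
  "stopped T t y = (\<lambda>u\<in>{0..T}. y (min u t))"

definition stopped_paths :: "real \<Rightarrow> real \<Rightarrow> (real \<times> (real \<Rightarrow> 'a::real_normed_vector)) set" where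
  "stopped_paths \<alpha> T = {(t, stopped T t y) | t y. t \<in> {0..T} \<and> y \<in> holder_space \<alpha> T}"

definition stopped_dist ::
    "real \<Rightarrow> real \<Rightarrow> real \<times> (real \<Rightarrow> 'a::real_normed_vector) \<Rightarrow> real \<times> (real \<Rightarrow> 'a) \<Rightarrow> real" where
  "stopped_dist \<beta> T = (\<lambda>(t, y) (s, z).
     \<bar>t - s\<bar> + norm (y 0 - z 0) + holder_seminorm \<beta> T (\<lambda>u. y u - z u))"

definition stopped_topology ::
    "real \<Rightarrow> real \<Rightarrow> real \<Rightarrow> (real \<times> (real \<Rightarrow> 'a::real_normed_vector)) topology" where
  "stopped_topology \<alpha> \<beta> T = Metric_space.mtopology (stopped_paths \<alpha> T) (stopped_dist \<beta> T)"


section \<open>These are metric spaces\<close>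

lemma holder_quotients_nonempty: "0 < T \<Longrightarrow> holder_quotients \<gamma> T y \<noteq> {}"
  unfolding holder_quotients_def by blast

lemma holder_quotients_nonneg: "q \<in> holder_quotients \<gamma> T y \<Longrightarrow> 0 \<le> q"
  by (auto simp: holder_quotients_def)

lemma holder_seminorm_nonneg:
  assumes "0 < T"
  shows "0 \<le> holder_seminorm \<gamma> T y"
proof -
  obtain q where q: "q \<in> holder_quotients \<gamma> T y"
    using holder_quotients_nonempty[OF assms, of \<gamma> y] by blast
  then show ?thesis
    using cSup_upper2[OF q] holder_quotients_nonneg[OF q] by (simp add: holder_seminorm_def)
qed

lemma holder_seminorm_minus_commute:
  "holder_seminorm \<gamma> T (\<lambda>t. y t - z t) = holder_seminorm \<gamma> T (\<lambda>t. z t - y t)"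
proof -
  have "norm (y t - z t - (y s - z s)) = norm (z t - y t - (z s - y s))" for s t
    by (metis minus_diff_eq norm_minus_commute minus_diff_minus)
  then show ?thesis
    unfolding holder_seminorm_def holder_quotients_def by simp
qed

lemma holder_seminorm_bound:
  assumes "bdd_above (holder_quotients \<gamma> T y)" "0 \<le> s" "s < t" "t \<le> T"
  shows "norm (y t - y s) \<le> holder_seminorm \<gamma> T y * (t - s) powr \<gamma>"
proof -
  have "norm (y t - y s) / \<bar>t - s\<bar> powr \<gamma> \<in> holder_quotients \<gamma> T y"
    unfolding holder_quotients_def using assms by blast
  then have "norm (y t - y s) / \<bar>t - s\<bar> powr \<gamma> \<le> holder_seminorm \<gamma> T y"
    unfolding holder_seminorm_def using assms(1) by (simp add: cSup_upper)
  then show ?thesis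
    using assms by (simp add: divide_le_eq)
qed

lemma holder_seminorm_least:
  assumes "0 < T"
    and "\<And>s t. \<lbrakk>0 \<le> s; s < t; t \<le> T\<rbrakk> \<Longrightarrow> norm (y t - y s) \<le> C * (t - s) powr \<gamma>"
  shows "bdd_above (holder_quotients \<gamma> T y)" and "holder_seminorm \<gamma> T y \<le> C"
proof -
  have *: "q \<le> C" if "q \<in> holder_quotients \<gamma> T y" for q
    using that assms(2) by (auto simp: holder_quotients_def divide_le_eq)
  show bdd: "bdd_above (holder_quotients \<gamma> T y)"
    using * by (meson bdd_aboveI)
  show "holder_seminorm \<gamma> T y \<le> C"
    using bdd * cSup_least[OF holder_quotients_nonempty[OF assms(1)], of \<gamma> y C]
    by (simp add: holder_seminorm_def)
qed

lemma holder_seminorm_triangle: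
  assumes "0 < T" "bdd_above (holder_quotients \<gamma> T y)" "bdd_above (holder_quotients \<gamma> T z)"
  shows "bdd_above (holder_quotients \<gamma> T (\<lambda>t. y t + z t))"
    and "holder_seminorm \<gamma> T (\<lambda>t. y t + z t) \<le> holder_seminorm \<gamma> T y + holder_seminorm \<gamma> T z"
proof -
  have *: "norm ((y t + z t) - (y s + z s))
      \<le> (holder_seminorm \<gamma> T y + holder_seminorm \<gamma> T z) * (t - s) powr \<gamma>"
    if st: "0 \<le> s" "s < t" "t \<le> T" for s t
  proof -
    have "(y t + z t) - (y s + z s) = (y t - y s) + (z t - z s)" by simp
    then have "norm ((y t + z t) - (y s + z s)) \<le> norm (y t - y s) + norm (z t - z s)"
      by (metis norm_triangle_ineq)
    then show ?thesis
      using holder_seminorm_bound[OF assms(2) st] holder_seminorm_bound[OF assms(3) st]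
      by (simp add: distrib_right)
  qed
  show "bdd_above (holder_quotients \<gamma> T (\<lambda>t. y t + z t))"
    and "holder_seminorm \<gamma> T (\<lambda>t. y t + z t) \<le> holder_seminorm \<gamma> T y + holder_seminorm \<gamma> T z"
    using holder_seminorm_least[OF assms(1), of "\<lambda>t. y t + z t", OF *] by simp_all
qed

lemma holder_bdd_mono:
  assumes "0 < T" "\<beta> \<le> \<alpha>" "bdd_above (holder_quotients \<alpha> T y)"
  shows "bdd_above (holder_quotients \<beta> T y)"
proof (rule holder_seminorm_least(1)[OF assms(1)])
  fix s t :: real assume st: "0 \<le> s" "s < t" "t \<le> T"
  have "(t - s) powr \<alpha> = (t - s) powr (\<alpha> - \<beta>) * (t - s) powr \<beta>"
    using st by (simp add: powr_add[symmetric])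
  also have "\<dots> \<le> T powr (\<alpha> - \<beta>) * (t - s) powr \<beta>"
    using st assms by (intro mult_right_mono powr_mono2) auto
  finally have "holder_seminorm \<alpha> T y * (t - s) powr \<alpha>
      \<le> holder_seminorm \<alpha> T y * (T powr (\<alpha> - \<beta>) * (t - s) powr \<beta>)"
    using holder_seminorm_nonneg[OF assms(1)] by (rule mult_left_mono)
  with holder_seminorm_bound[OF assms(3) st]
  show "norm (y t - y s) \<le> (holder_seminorm \<alpha> T y * T powr (\<alpha> - \<beta>)) * (t - s) powr \<beta>"
    by (simp add: mult.assoc)
qed

lemma holder_bdd_diff:
  assumes "0 < T" "\<beta> \<le> \<alpha>" "y \<in> holder_space \<alpha> T" "z \<in> holder_space \<alpha> T"
  shows "bdd_above (holder_quotients \<beta> T (\<lambda>t. y t - z t))"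
proof -
  have m: "norm (- z t - - z s) = norm (z t - z s)" for s t
    by (simp add: norm_minus_commute)
  have "holder_quotients \<beta> T (\<lambda>t. - z t) = holder_quotients \<beta> T z"
    unfolding holder_quotients_def m ..
  then have "bdd_above (holder_quotients \<beta> T (\<lambda>t. - z t))"
    using assms holder_bdd_mono by (auto simp: holder_space_def)
  moreover have "bdd_above (holder_quotients \<beta> T y)"
    using assms holder_bdd_mono by (auto simp: holder_space_def)
  ultimately have "bdd_above (holder_quotients \<beta> T (\<lambda>t. y t + - z t))"
    by (intro holder_seminorm_triangle(1)[OF assms(1)])
  then show ?thesis by simp
qed

lemma holder_norm_zero_imp_eq:
  assumes "0 < T" "\<beta> \<le> \<alpha>" "y \<in> holder_space \<alpha> T" "z \<in> holder_space \<alpha> T"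
    and "y 0 = z 0" "holder_seminorm \<beta> T (\<lambda>t. y t - z t) = 0"
  shows "y = z"
proof (rule extensionalityI)
  show "y \<in> extensional {0..T}" "z \<in> extensional {0..T}"
    using assms by (auto simp: holder_space_def)
  fix t assume t: "t \<in> {0..T}"
  show "y t = z t"
  proof (cases "t = 0")
    case False
    then show ?thesis
      using holder_seminorm_bound[OF holder_bdd_diff[OF assms(1-4)], of 0 t] t assms(5,6) by simp
  qed (use assms in simp)
qed

lemma holder_seminorm_diff_triangle:
  assumes "0 < T" "\<beta> \<le> \<alpha>"
    "y \<in> holder_space \<alpha> T" "z \<in> holder_space \<alpha> T" "w \<in> holder_space \<alpha> T"
  shows "holder_seminorm \<beta> T (\<lambda>t. y t - w t)
    \<le> holder_seminorm \<beta> T (\<lambda>t. y t - z t) + holder_seminorm \<beta> T (\<lambda>t. z t - w t)"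
  using holder_seminorm_triangle(2)[OF assms(1) holder_bdd_diff[OF assms(1-4)]
      holder_bdd_diff[OF assms(1,2,4,5)]] by simp

lemma holder_seminorm_zero: "0 < T \<Longrightarrow> holder_seminorm \<beta> T (\<lambda>t. 0) = 0"
  by (intro order_antisym holder_seminorm_least(2) holder_seminorm_nonneg) simp_all

lemma Metric_space_holder:
  assumes "0 < T" "\<beta> \<le> \<alpha>"
  shows "Metric_space (holder_space \<alpha> T) (holder_dist \<beta> T)"
proof
  fix x y z :: "real \<Rightarrow> 'a"
  show "0 \<le> holder_dist \<beta> T x y"
    by (simp add: holder_dist_def holder_norm_def holder_seminorm_nonneg[OF assms(1)])
  show "holder_dist \<beta> T x y = holder_dist \<beta> T y x"
    using holder_seminorm_minus_commute[of \<beta> T x y]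
    by (simp add: holder_dist_def holder_norm_def norm_minus_commute)
  assume x: "x \<in> holder_space \<alpha> T" and y: "y \<in> holder_space \<alpha> T"
  show "holder_dist \<beta> T x y = 0 \<longleftrightarrow> x = y"
  proof
    assume "holder_dist \<beta> T x y = 0"
    then have "norm (x 0 - y 0) = 0" "holder_seminorm \<beta> T (\<lambda>t. x t - y t) = 0"
      using holder_seminorm_nonneg[OF assms(1), of \<beta> "\<lambda>t. x t - y t"]
      by (simp_all add: holder_dist_def holder_norm_def add_nonneg_eq_0_iff)
    then show "x = y"
      using holder_norm_zero_imp_eq[OF assms x y] by simp
  qed (simp add: holder_dist_def holder_norm_def holder_seminorm_zero[OF assms(1)])
  assume z: "z \<in> holder_space \<alpha> T"
  show "holder_dist \<beta> T x z \<le> holder_dist \<beta> T x y + holder_dist \<beta> T y z"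
    using holder_seminorm_diff_triangle[OF assms x y z] norm_triangle_ineq[of "x 0 - y 0" "y 0 - z 0"]
    by (simp add: holder_dist_def holder_norm_def)
qed

lemma stopped_in_holder_space:
  assumes "0 < T" "0 \<le> \<alpha>" "y \<in> holder_space \<alpha> T" "t \<in> {0..T}"
  shows "stopped T t y \<in> holder_space \<alpha> T"
proof -
  have bdd: "bdd_above (holder_quotients \<alpha> T y)"
    using assms by (simp add: holder_space_def)
  have "bdd_above (holder_quotients \<alpha> T (stopped T t y))"
  proof (rule holder_seminorm_least(1)[OF assms(1)])
    fix r s :: real assume rs: "0 \<le> r" "r < s" "s \<le> T"
    show "norm (stopped T t y s - stopped T t y r) \<le> holder_seminorm \<alpha> T y * (s - r) powr \<alpha>"
    proof (cases "r < t")
      case True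
      then have "norm (y (min s t) - y (min r t))
          \<le> holder_seminorm \<alpha> T y * (min s t - min r t) powr \<alpha>"
        using rs assms by (intro holder_seminorm_bound[OF bdd]) auto
      also have "\<dots> \<le> holder_seminorm \<alpha> T y * (s - r) powr \<alpha>"
        using rs assms True
        by (intro mult_left_mono powr_mono2 holder_seminorm_nonneg) auto
      finally show ?thesis using rs by (simp add: stopped_def)
    next
      case False
      then have "min s t = min r t" using rs by simp
      then show ?thesis
        using rs holder_seminorm_nonneg[OF assms(1), of \<alpha> y] by (simp add: stopped_def)
    qed
  qed
  then show ?thesis by (simp add: holder_space_def stopped_def)
qed

lemma stopped_paths_subset:
  assumes "0 < T" "0 \<le> \<alpha>" "p \<in> stopped_paths \<alpha> T"
  shows "snd p \<in> holder_space \<alpha> T"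
  using assms(3) stopped_in_holder_space[OF assms(1,2)] by (force simp: stopped_paths_def)

lemma stopped_dist_eq: "stopped_dist \<beta> T p q = \<bar>fst p - fst q\<bar> + holder_dist \<beta> T (snd p) (snd q)"
  by (simp add: stopped_dist_def holder_dist_def holder_norm_def split_beta)

lemma Metric_space_stopped:
  assumes "0 < T" "0 \<le> \<alpha>" "\<beta> \<le> \<alpha>"
  shows "Metric_space (stopped_paths \<alpha> T) (stopped_dist \<beta> T)"
proof -
  interpret H: Metric_space "holder_space \<alpha> T" "holder_dist \<beta> T"
    using Metric_space_holder assms by blast
  note sub = stopped_paths_subset[OF assms(1,2)]
  show ?thesis
  proof
    fix p q r :: "real \<times> (real \<Rightarrow> 'a)"
    show "0 \<le> stopped_dist \<beta> T p q"
      by (simp add: stopped_dist_eq)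
    show "stopped_dist \<beta> T p q = stopped_dist \<beta> T q p"
      by (simp add: stopped_dist_eq H.commute abs_minus_commute)
    assume p: "p \<in> stopped_paths \<alpha> T" and q: "q \<in> stopped_paths \<alpha> T"
    show "stopped_dist \<beta> T p q = 0 \<longleftrightarrow> p = q"
      using sub[OF p] sub[OF q]
      by (auto simp: stopped_dist_eq add_nonneg_eq_0_iff prod_eq_iff)
    assume r: "r \<in> stopped_paths \<alpha> T"
    show "stopped_dist \<beta> T p r \<le> stopped_dist \<beta> T p q + stopped_dist \<beta> T q r"
      using H.triangle[OF sub[OF p] sub[OF q] sub[OF r]] by (simp add: stopped_dist_eq)
  qed
qed


section \<open>Riemann--Stieltjes integral\<close>

text \<open>
  The integral of \<open>F\<close> against \<open>g\<close> over \<open>[a,b]\<close> is the limit of the tagged Riemann--Stieltjes sums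
  as the mesh tends to \<open>0\<close>.
\<close>

definition has_RS_integral ::
    "(real \<Rightarrow> 'a::real_normed_vector) \<Rightarrow> (real \<Rightarrow> real) \<Rightarrow> real \<Rightarrow> real \<Rightarrow> 'a \<Rightarrow> bool" where
  "has_RS_integral F g a b I \<longleftrightarrow>
     (\<forall>\<epsilon>>0. \<exists>\<delta>>0. \<forall>p. p tagged_division_of {a..b} \<and> (\<forall>(\<xi>, K)\<in>p. Sup K - Inf K < \<delta>) \<longrightarrow>
        norm ((\<Sum>(\<xi>, K)\<in>p. (g (Sup K) - g (Inf K)) *\<^sub>R F \<xi>) - I) < \<epsilon>)"

definition RS_integrable ::
    "(real \<Rightarrow> 'a::real_normed_vector) \<Rightarrow> (real \<Rightarrow> real) \<Rightarrow> real \<Rightarrow> real \<Rightarrow> bool" where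
  "RS_integrable F g a b \<longleftrightarrow> (\<exists>I. has_RS_integral F g a b I)"

definition RS_integral ::
    "(real \<Rightarrow> 'a::real_normed_vector) \<Rightarrow> (real \<Rightarrow> real) \<Rightarrow> real \<Rightarrow> real \<Rightarrow> 'a" where
  "RS_integral F g a b = (THE I. has_RS_integral F g a b I)"

lemma has_RS_integral_unique:
  assumes "has_RS_integral F g a b I" "has_RS_integral F g a b J"
  shows "I = J"
proof (rule ccontr)
  assume "I \<noteq> J"
  define \<epsilon> where "\<epsilon> = norm (I - J) / 2"
  have \<epsilon>: "\<epsilon> > 0" using \<open>I \<noteq> J\<close> by (simp add: \<epsilon>_def)
  let ?S = "\<lambda>p. \<Sum>(\<xi>, K)\<in>p. (g (Sup K) - g (Inf K)) *\<^sub>R F \<xi>"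
  obtain d1 where d1: "d1 > 0" "\<And>p. \<lbrakk>p tagged_division_of {a..b}; \<forall>(\<xi>, K)\<in>p. Sup K - Inf K < d1\<rbrakk>
      \<Longrightarrow> norm (?S p - I) < \<epsilon>"
    using assms(1) \<epsilon> unfolding has_RS_integral_def by meson
  obtain d2 where d2: "d2 > 0" "\<And>p. \<lbrakk>p tagged_division_of {a..b}; \<forall>(\<xi>, K)\<in>p. Sup K - Inf K < d2\<rbrakk>
      \<Longrightarrow> norm (?S p - J) < \<epsilon>"
    using assms(2) \<epsilon> unfolding has_RS_integral_def by meson
  define d where "d = min d1 d2 / 2"
  have d: "d > 0" using d1 d2 by (simp add: d_def)
  obtain p where p: "p tagged_division_of {a..b}" "(\<lambda>x. ball x d) fine p"
    using fine_division_exists_real[OF gauge_ball[OF d]] by blast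
  have mesh: "Sup K - Inf K < min d1 d2" if K: "(\<xi>, K) \<in> p" for \<xi> K
  proof -
    obtain u v where uv: "K = {u..v}" using tagged_division_ofD(4)[OF p(1) K] by auto
    have "\<xi> \<in> K" using tagged_division_ofD(2)[OF p(1) K] .
    then have "u \<in> K" "v \<in> K" "u \<le> v" unfolding uv by simp_all
    moreover have "K \<subseteq> ball \<xi> d" using p(2) K by (auto simp: fine_def)
    ultimately have "u \<in> ball \<xi> d" "v \<in> ball \<xi> d" "u \<le> v" by blast+
    then have "v - u < 2 * d" by (simp add: dist_real_def)
    then show ?thesis using \<open>u \<le> v\<close> by (simp add: uv d_def)
  qed
  have "norm (?S p - I) < \<epsilon>" "norm (?S p - J) < \<epsilon>"
    using d1(2)[OF p(1)] d2(2)[OF p(1)] mesh by fastforce+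
  then have "norm (I - J) < 2 * \<epsilon>"
    using norm_triangle_ineq4[of "?S p - J" "?S p - I"] by simp
  then show False by (simp add: \<epsilon>_def)
qed

lemma RS_integral_eq: "has_RS_integral F g a b I \<Longrightarrow> RS_integral F g a b = I"
  unfolding RS_integral_def using has_RS_integral_unique by blast

text \<open>
  For an integrand with values in the linear maps and a vector-valued integrator, the integral is
  the sum over \<open>j\<close> of the integrals of the \<open>j\<close>-th column against the \<open>j\<close>-th coordinate.
\<close>

definition column_of :: "((real^'d) \<Rightarrow>\<^sub>L (real^'m)) \<Rightarrow> 'd \<Rightarrow> real^'m" where
  "column_of A j = blinfun_apply A (axis j 1)"

definition RS_integrable_vec ::
    "(real \<Rightarrow> ((real^'d) \<Rightarrow>\<^sub>L (real^'m))) \<Rightarrow> (real \<Rightarrow> real^'d) \<Rightarrow> real \<Rightarrow> real \<Rightarrow> bool" where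
  "RS_integrable_vec F x a b \<longleftrightarrow> (\<forall>j. RS_integrable (\<lambda>s. column_of (F s) j) (\<lambda>s. x s $ j) a b)"

definition RS_integral_vec ::
    "(real \<Rightarrow> ((real^'d) \<Rightarrow>\<^sub>L (real^'m))) \<Rightarrow> (real \<Rightarrow> real^'d) \<Rightarrow> real \<Rightarrow> real \<Rightarrow> real^'m" where
  "RS_integral_vec F x a b = (\<Sum>j\<in>UNIV. RS_integral (\<lambda>s. column_of (F s) j) (\<lambda>s. x s $ j) a b)"


section \<open>Path-dependent controlled differential equation\<close>

text \<open>
  Solutions on \<open>[0,T']\<close>, \<open>T' \<le> T\<^sub>1\<close>. The integrand needs \<open>y\<close> only on \<open>[0,s]\<close> with \<open>s \<le> T'\<close>; the
  stopped path \<open>stopped T\<^sub>1 s y\<close> is a path on all of \<open>[0,T\<^sub>1]\<close>.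
\<close>

definition is_CDE_solution ::
    "real \<Rightarrow> real \<Rightarrow> real \<Rightarrow> (real \<times> (real \<Rightarrow> real^'m) \<Rightarrow> ((real^'d) \<Rightarrow>\<^sub>L (real^'m))) \<Rightarrow> (real \<Rightarrow> real^'d)
      \<Rightarrow> (real \<Rightarrow> real^'m) \<Rightarrow> real \<Rightarrow> (real \<Rightarrow> real^'m) \<Rightarrow> bool" where
  "is_CDE_solution \<alpha> T\<^sub>0 T\<^sub>1 f x w T' y \<longleftrightarrow>
     y \<in> holder_space \<alpha> T' \<and>
     (\<forall>t\<in>{0..T'}. t \<le> T\<^sub>0 \<longrightarrow> y t = w t) \<and>
     (\<forall>t\<in>{0..T'}. T\<^sub>0 \<le> t \<longrightarrow>
        RS_integrable_vec (\<lambda>s. f (s, stopped T\<^sub>1 s y)) x T\<^sub>0 t \<and>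
        y t = w T\<^sub>0 + RS_integral_vec (\<lambda>s. f (s, stopped T\<^sub>1 s y)) x T\<^sub>0 t)"

end

theory Submission
  imports Defs "HOL-Complex_Analysis.Great_Picard"
begin

text \<open>
  Riemann--Stieltjes integrals of continuous functions against a Lipschitz \<open>g\<close> exist because \<open>g\<close> is
  the difference of the nondecreasing functions \<open>L r + g r\<close> and \<open>L r\<close>, for which the integral
  against the Lebesgue--Stieltjes measure is a primitive.

  The solution is found on all of \<open>[0,T\<^sub>1]\<close> at once by Picard iteration, with increments over \<open>[s,t]\<close>
  measured by multiples of \<open>exp (\<mu> t) - exp (\<mu> s)\<close>. A path \<open>z\<close> whose increments are at most \<open>\<rho>\<close> times
  this has \<open>\<beta>\<close>-Hoelder seminorm at most \<open>\<rho> \<mu>\<^sup>\<beta> exp (\<mu> t)\<close> when stopped at \<open>t\<close>, and integrating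
  \<open>exp (\<mu> t)\<close> gains a factor \<open>1/\<mu>\<close>. As \<open>\<beta> < 1\<close>, for large \<open>\<mu>\<close> linear growth yields an invariant set of paths
  near the stopped initial path. This set lies in an \<open>\<alpha>\<close>-Hoelder ball, which is compact for the \<open>\<beta>\<close>-norm
  by Arzela--Ascoli and interpolation, so that one Lipschitz constant applies to it and the solution
  map halves \<open>\<rho>\<close> for a possibly larger \<open>\<mu>\<close>. Any two solutions also lie in a common \<open>\<alpha>\<close>-Hoelder ball,
  and the same contraction gives uniqueness.
\<close>

section \<open>Riemann--Stieltjes integrals against Lipschitz paths\<close>

text \<open>Take for \<open>J\<close> the Lebesgue-Stieltjes integral of \<open>F\<close> over
  half-open intervals starting at \<open>a\<close>. Continuity of \<open>h\<close> gives each
  interval the mass \<open>h v - h u\<close>, and integrating \<open>F - c\<close> yields the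
  estimate. The constant \<open>c\<close> is left free so that it can later be the value of
  \<open>F\<close> at any tag.\<close>

lemma monotone_integrator_primitive:
  fixes F :: "real \<Rightarrow> 'a::euclidean_space"
  assumes mono_h: "\<And>s t. s \<le> t \<Longrightarrow> h s \<le> h t" and cont_h: "continuous_on UNIV h"
    and cont_F: "continuous_on {a..b} F" and "a \<le> b"
  obtains J where "\<And>u v c \<epsilon>. \<lbrakk>a \<le> u; u \<le> v; v \<le> b; \<And>r. r \<in> {u..v} \<Longrightarrow> norm (F r - c) \<le> \<epsilon>\<rbrakk>
      \<Longrightarrow> norm (J v - J u - (h v - h u) *\<^sub>R c) \<le> \<epsilon> * (h v - h u)"
proof
  define M where "M = interval_measure h"
  \<comment> \<open>Composing with the clamp gives a function that is continuous, hence measurable,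
    on the whole line and agrees with \<open>F\<close> on \<open>[a,b]\<close>.\<close>
  define G where "G = (\<lambda>r. F (max a (min b r)))"
  define J where "J = (\<lambda>v. LINT r:{a<..v}|M. G r)"
  have right: "continuous (at_right r) h" for r
    using cont_h by (meson UNIV_I continuous_on_eq_continuous_within continuous_within_subset subset_UNIV)
  have emeasure_M: "emeasure M {u<..v} = ennreal (h v - h u)" if "u \<le> v" for u v
    unfolding M_def using emeasure_interval_measure_Ioc[OF that mono_h right] by simp
  have measure_M: "measure M {u<..v} = h v - h u" if "u \<le> v" for u v
    unfolding M_def using measure_interval_measure_Ioc[OF that mono_h right] by simp
  have sets_M: "sets M = sets borel" by (simp add: M_def)
  have "continuous_on UNIV G"
    unfolding G_def
    by (rule continuous_on_compose2[OF cont_F]) (use \<open>a \<le> b\<close> in \<open>auto intro!: continuous_intros\<close>)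
  then have meas_G: "G \<in> borel_measurable M"
    using borel_measurable_continuous_onI measurable_cong_sets[OF sets_M refl] by blast
  have "compact (F ` {a..b})"
    using cont_F compact_continuous_image by blast
  then obtain B where B: "\<And>r. r \<in> {a..b} \<Longrightarrow> norm (F r) \<le> B"
    using compact_imp_bounded bounded_iff by (metis imageI)
  have int_G: "set_integrable M {u<..v} G" if "u \<le> v" for u v
    unfolding set_integrable_def
  proof (rule integrableI_bounded_set[where A = "{u<..v}" and B = B])
    show "{u<..v} \<in> sets M" by (simp add: sets_M)
    then show "(\<lambda>r. indicat_real {u<..v} r *\<^sub>R G r) \<in> borel_measurable M"
      using meas_G by measurable
    show "emeasure M {u<..v} < \<infinity>" using emeasure_M[OF that] by simp
    have "norm (G r) \<le> B" for r
      unfolding G_def by (rule B) (use \<open>a \<le> b\<close> in auto)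
    then show "AE r in M. r \<in> {u<..v} \<longrightarrow> norm (indicat_real {u<..v} r *\<^sub>R G r) \<le> B"
      by (auto simp: indicator_def)
  qed auto
  fix u v c \<epsilon>
  assume uv: "a \<le> u" "u \<le> v" "v \<le> b" and near: "\<And>r. r \<in> {u..v} \<Longrightarrow> norm (F r - c) \<le> \<epsilon>"
  have "J v = J u + (LINT r:{u<..v}|M. G r)"
  proof -
    have "{a<..v} = {a<..u} \<union> {u<..v}" using uv by auto
    then show ?thesis
      unfolding J_def using set_integral_Un[OF _ int_G int_G, of a u u v] uv by auto
  qed
  moreover have int_c: "set_integrable M {u<..v} (\<lambda>r. c)"
    unfolding set_integrable_def
    using integrable_real_indicator[of "{u<..v}" M] emeasure_M[OF uv(2)]
    by (auto simp: sets_M intro!: integrable_scaleR_left)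
  moreover have "(LINT r:{u<..v}|M. c) = (h v - h u) *\<^sub>R c"
    unfolding set_lebesgue_integral_def using measure_M[OF uv(2)] emeasure_M[OF uv(2)] by (simp add: sets_M)
  ultimately have "J v - J u - (h v - h u) *\<^sub>R c = (LINT r:{u<..v}|M. G r - c)"
    using set_integral_diff(2)[OF int_G[OF uv(2)] int_c] by simp
  also have "norm \<dots> \<le> (LINT r:{u<..v}|M. norm (G r - c))"
    by (rule set_integral_norm_bound[OF set_integral_diff(1)[OF int_G[OF uv(2)] int_c]])
  also have "\<dots> \<le> (LINT r:{u<..v}|M. \<epsilon>)"
  proof (rule set_integral_mono)
    show "set_integrable M {u<..v} (\<lambda>r. norm (G r - c))"
      using set_integral_diff(1)[OF int_G[OF uv(2)] int_c] by (rule set_integrable_norm)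
    show "set_integrable M {u<..v} (\<lambda>r. \<epsilon>)"
      unfolding set_integrable_def
      using integrable_real_indicator[of "{u<..v}" M] emeasure_M[OF uv(2)]
      by (auto simp: sets_M intro!: integrable_scaleR_left)
    show "norm (G r - c) \<le> \<epsilon>" if "r \<in> {u<..v}" for r
      using near[of r] that uv by (simp add: G_def min_absorb2 max_absorb2)
  qed
  also have "\<dots> = \<epsilon> * (h v - h u)"
    unfolding set_lebesgue_integral_def using measure_M[OF uv(2)] emeasure_M[OF uv(2)] by (simp add: sets_M)
  finally show "norm (J v - J u - (h v - h u) *\<^sub>R c) \<le> \<epsilon> * (h v - h u)" .
qed

text \<open>If the increments of \<open>J\<close> match single Riemann-Stieltjes terms up to
  \<open>\<epsilon> * (v - u)\<close>, then over a tagged division the errors add up to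
  \<open>\<epsilon> * (b - a)\<close> while the increments of \<open>J\<close> telescope. The
  \<open>\<delta>\<close> is uniform over all tags, as convergence by mesh demands.\<close>

lemma has_RS_integral_primitive:
  fixes F :: "real \<Rightarrow> 'a::real_normed_vector"
  assumes "a \<le> b"
    and approx: "\<And>\<epsilon>. \<epsilon> > 0 \<Longrightarrow> \<exists>\<delta>>0. \<forall>u v \<xi>. a \<le> u \<and> u \<le> \<xi> \<and> \<xi> \<le> v \<and> v \<le> b \<and> v - u < \<delta>
      \<longrightarrow> norm (J v - J u - (g v - g u) *\<^sub>R F \<xi>) \<le> \<epsilon> * (v - u)"
  shows "has_RS_integral F g a b (J b - J a)"
  unfolding has_RS_integral_def
proof (intro allI impI)
  fix \<epsilon> :: real assume "\<epsilon> > 0"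
  define \<eta> where "\<eta> = \<epsilon> / (b - a + 1)"
  have "\<eta> > 0" using \<open>\<epsilon> > 0\<close> \<open>a \<le> b\<close> by (simp add: \<eta>_def)
  have "\<eta> * (b - a) < \<epsilon>"
    using \<open>\<epsilon> > 0\<close> \<open>a \<le> b\<close> by (simp add: \<eta>_def field_simps)
  obtain \<delta> where "\<delta> > 0" and \<delta>: "\<And>u v \<xi>. \<lbrakk>a \<le> u; u \<le> \<xi>; \<xi> \<le> v; v \<le> b; v - u < \<delta>\<rbrakk>
      \<Longrightarrow> norm (J v - J u - (g v - g u) *\<^sub>R F \<xi>) \<le> \<eta> * (v - u)"
    using approx[OF \<open>\<eta> > 0\<close>] by blast
  show "\<exists>\<delta>>0. \<forall>p. p tagged_division_of {a..b} \<and> (\<forall>(\<xi>, K)\<in>p. Sup K - Inf K < \<delta>) \<longrightarrow>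
        norm ((\<Sum>(\<xi>, K)\<in>p. (g (Sup K) - g (Inf K)) *\<^sub>R F \<xi>) - (J b - J a)) < \<epsilon>"
  proof (intro exI[of _ \<delta>] conjI allI impI; (elim conjE)?)
    fix p assume p: "p tagged_division_of {a..b}" and mesh: "\<forall>(\<xi>, K)\<in>p. Sup K - Inf K < \<delta>"
    have "norm ((\<Sum>(\<xi>, K)\<in>p. (g (Sup K) - g (Inf K)) *\<^sub>R F \<xi>) - (J b - J a))
        = norm (\<Sum>(\<xi>, K)\<in>p. (g (Sup K) - g (Inf K)) *\<^sub>R F \<xi> - (J (Sup K) - J (Inf K)))"
      unfolding additive_tagged_division_1[OF \<open>a \<le> b\<close> p, of J, symmetric] sum_subtractf[symmetric]
      by (simp add: split_def)
    also have "\<dots> \<le> (\<Sum>(\<xi>, K)\<in>p. \<eta> * (Sup K - Inf K))"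
    proof (rule sum_norm_le, clarify)
      fix \<xi> K assume K: "(\<xi>, K) \<in> p"
      obtain u v where uv: "K = {u..v}" using tagged_division_ofD(4)[OF p K] by auto
      have "\<xi> \<in> K" "K \<subseteq> {a..b}" using tagged_division_ofD(2,3)[OF p K] by auto
      then have "a \<le> u" "u \<le> \<xi>" "\<xi> \<le> v" "v \<le> b" "Inf K = u" "Sup K = v" unfolding uv by auto
      moreover have "Sup K - Inf K < \<delta>" using mesh K by blast
      ultimately show "norm ((g (Sup K) - g (Inf K)) *\<^sub>R F \<xi> - (J (Sup K) - J (Inf K))) \<le> \<eta> * (Sup K - Inf K)"
        using \<delta>[of u \<xi> v] by (simp add: norm_minus_commute)
    qed
    also have "\<dots> = \<eta> * (b - a)"
      using additive_tagged_division_1[OF \<open>a \<le> b\<close> p, of "\<lambda>r. r"]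
      by (simp add: sum_distrib_left[symmetric] split_def)
    finally show "norm ((\<Sum>(\<xi>, K)\<in>p. (g (Sup K) - g (Inf K)) *\<^sub>R F \<xi>) - (J b - J a)) < \<epsilon>"
      using \<open>\<eta> * (b - a) < \<epsilon>\<close> by linarith
  qed (rule \<open>\<delta> > 0\<close>)
qed

text \<open>Subtracting the primitives for two nondecreasing integrators gives one for
  \<open>g\<close>. A single \<open>J\<close> for all subintervals makes additivity of the integral
  immediate.\<close>

lemma RS_primitive_exists:
  fixes F :: "real \<Rightarrow> 'a::euclidean_space"
  assumes lip: "L-lipschitz_on {a..b} g" and cont_F: "continuous_on {a..b} F" and "a \<le> b"
  obtains J where "\<And>u v. \<lbrakk>a \<le> u; u \<le> v; v \<le> b\<rbrakk> \<Longrightarrow> has_RS_integral F g u v (J v - J u)"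
proof -
  \<comment> \<open>Clamping extends \<open>g\<close> to the whole line with the same Lipschitz
    bound, since the monotone integrators must be nondecreasing and continuous everywhere.\<close>
  define c where "c = (\<lambda>r. max a (min b r))"
  have "L \<ge> 0" using lip by (rule lipschitz_on_nonneg)
  define h where "h = (\<lambda>r. L * r + g (c r))"
  define k where "k = (\<lambda>r. L * r)"
  have c_in: "c r \<in> {a..b}" for r using \<open>a \<le> b\<close> by (auto simp: c_def)
  have c_diff: "\<bar>g (c t) - g (c s)\<bar> \<le> L * (t - s)" if "s \<le> t" for s t
  proof -
    have "\<bar>g (c t) - g (c s)\<bar> \<le> L * \<bar>c t - c s\<bar>"
      using lipschitz_onD[OF lip c_in c_in, of t s] by (simp add: dist_real_def)
    also have "\<bar>c t - c s\<bar> \<le> t - s" using that by (auto simp: c_def)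
    finally show ?thesis using \<open>L \<ge> 0\<close> by (simp add: mult_left_mono)
  qed
  have mono_h: "h s \<le> h t" if "s \<le> t" for s t
    using c_diff[OF that] by (simp add: h_def algebra_simps)
  have mono_k: "k s \<le> k t" if "s \<le> t" for s t
    using that \<open>L \<ge> 0\<close> by (simp add: k_def mult_left_mono)
  have "continuous_on UNIV (\<lambda>r. g (c r))"
    by (rule continuous_on_compose2[OF lipschitz_on_continuous_on[OF lip]])
      (use c_in in \<open>auto simp: c_def intro!: continuous_intros\<close>)
  then have "continuous_on UNIV h" "continuous_on UNIV k"
    unfolding h_def k_def by (auto intro!: continuous_intros)
  obtain H where H: "\<And>u v c \<epsilon>. \<lbrakk>a \<le> u; u \<le> v; v \<le> b; \<And>r. r \<in> {u..v} \<Longrightarrow> norm (F r - c) \<le> \<epsilon>\<rbrakk>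
      \<Longrightarrow> norm (H v - H u - (h v - h u) *\<^sub>R c) \<le> \<epsilon> * (h v - h u)"
    using monotone_integrator_primitive[OF mono_h \<open>continuous_on UNIV h\<close> cont_F \<open>a \<le> b\<close>] by blast
  obtain K where K: "\<And>u v c \<epsilon>. \<lbrakk>a \<le> u; u \<le> v; v \<le> b; \<And>r. r \<in> {u..v} \<Longrightarrow> norm (F r - c) \<le> \<epsilon>\<rbrakk>
      \<Longrightarrow> norm (K v - K u - (k v - k u) *\<^sub>R c) \<le> \<epsilon> * (k v - k u)"
    using monotone_integrator_primitive[OF mono_k \<open>continuous_on UNIV k\<close> cont_F \<open>a \<le> b\<close>] by blast
  define J where "J = (\<lambda>r. H r - K r)"
  have unif: "uniformly_continuous_on {a..b} F"
    using cont_F by (simp add: compact_uniformly_continuous)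
  have J: "has_RS_integral F g u v (J v - J u)" if uv: "a \<le> u" "u \<le> v" "v \<le> b" for u v
  proof (rule has_RS_integral_primitive[OF uv(2)])
    fix \<epsilon> :: real assume "\<epsilon> > 0"
    \<comment> \<open>The increments of \<open>h\<close> and \<open>k\<close> total at most
      \<open>3 * L * (t - s)\<close>: at most \<open>2 * L\<close> per unit time from
      \<open>h\<close>, and \<open>L\<close> from \<open>k\<close>. The \<open>+ 1\<close> covers
      \<open>L = 0\<close>.\<close>
    define \<eta> where "\<eta> = \<epsilon> / (3 * L + 1)"
    have "\<eta> > 0" using \<open>\<epsilon> > 0\<close> \<open>L \<ge> 0\<close> by (simp add: \<eta>_def)
    have \<eta>: "\<eta> * (3 * L) \<le> \<epsilon>"
      using \<open>\<epsilon> > 0\<close> \<open>L \<ge> 0\<close> by (simp add: \<eta>_def field_simps)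
    obtain \<delta> where "\<delta> > 0" and \<delta>: "\<And>r s. \<lbrakk>r \<in> {a..b}; s \<in> {a..b}; \<bar>r - s\<bar> < \<delta>\<rbrakk> \<Longrightarrow> norm (F r - F s) < \<eta>"
      using unif \<open>\<eta> > 0\<close> unfolding uniformly_continuous_on_def dist_norm by (metis real_norm_def)
    have "norm (J t - J s - (g t - g s) *\<^sub>R F \<xi>) \<le> \<epsilon> * (t - s)"
      if st: "u \<le> s" "s \<le> \<xi>" "\<xi> \<le> t" "t \<le> v" "t - s < \<delta>" for s t \<xi>
    proof -
      have near: "norm (F r - F \<xi>) \<le> \<eta>" if "r \<in> {s..t}" for r
        using \<delta>[of r \<xi>] that st uv by fastforce
      have "c s = s" "c t = t" using st uv by (auto simp: c_def)
      then have g: "g t - g s = (h t - h s) - (k t - k s)"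
        by (simp add: h_def k_def)
      have "J t - J s - (g t - g s) *\<^sub>R F \<xi>
          = (H t - H s - (h t - h s) *\<^sub>R F \<xi>) - (K t - K s - (k t - k s) *\<^sub>R F \<xi>)"
        unfolding g J_def by (simp add: algebra_simps)
      also have "norm \<dots> \<le> \<eta> * (h t - h s) + \<eta> * (k t - k s)"
        by (rule order_trans[OF norm_triangle_ineq4 add_mono[OF H K]]) (use near st uv in auto)
      also have "\<dots> \<le> \<eta> * (3 * L * (t - s))"
      proof -
        have "(h t - h s) + (k t - k s) \<le> 3 * L * (t - s)"
          using c_diff[of s t] st by (simp add: h_def k_def algebra_simps)
        then show ?thesis using \<open>\<eta> > 0\<close> by (simp flip: distrib_left)
      qed
      also have "\<dots> \<le> \<epsilon> * (t - s)"
        using mult_right_mono[OF \<eta>, of "t - s"] st by (simp add: mult.assoc)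
      finally show ?thesis .
    qed
    then show "\<exists>\<delta>>0. \<forall>s t \<xi>. u \<le> s \<and> s \<le> \<xi> \<and> \<xi> \<le> t \<and> t \<le> v \<and> t - s < \<delta>
      \<longrightarrow> norm (J t - J s - (g t - g s) *\<^sub>R F \<xi>) \<le> \<epsilon> * (t - s)"
      using \<open>\<delta> > 0\<close> by blast
  qed
  show thesis by (rule that[OF J])
qed

text \<open>One tagged division serves both integrals: it is fine for a gauge adapted to
  \<open>\<phi>\<close> and has small mesh. The Riemann-Stieltjes sum of \<open>F\<close> is then
  dominated term by term by the gauge sum of \<open>\<phi>\<close>, and both sums are close to their
  limits.\<close>

lemma has_RS_integral_norm_le:
  assumes I: "has_RS_integral F g a b I" and "a \<le> b" and lip: "L-lipschitz_on {a..b} g"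
    and \<phi>: "(\<phi> has_integral A) {a..b}" and dom: "\<And>r. r \<in> {a..b} \<Longrightarrow> L * norm (F r) \<le> \<phi> r"
  shows "norm I \<le> A"
proof (rule field_le_epsilon)
  fix e :: real assume "e > 0"
  then have e: "e / 2 > 0" by simp
  obtain d where "d > 0" and d: "\<And>p. \<lbrakk>p tagged_division_of {a..b}; \<forall>(\<xi>, K)\<in>p. Sup K - Inf K < d\<rbrakk>
      \<Longrightarrow> norm ((\<Sum>(\<xi>, K)\<in>p. (g (Sup K) - g (Inf K)) *\<^sub>R F \<xi>) - I) < e / 2"
    using I e unfolding has_RS_integral_def by meson
  obtain \<gamma> where "gauge \<gamma>" and \<gamma>: "\<And>p. \<lbrakk>p tagged_division_of {a..b}; \<gamma> fine p\<rbrakk>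
      \<Longrightarrow> norm ((\<Sum>(\<xi>, K)\<in>p. measure lborel K *\<^sub>R \<phi> \<xi>) - A) < e / 2"
    using \<phi> e unfolding has_integral_real by meson
  \<comment> \<open>Balls of radius \<open>d / 2\<close> around the tags force every interval to be
    shorter than \<open>d\<close>, which turns fineness into a mesh bound.\<close>
  have "gauge (\<lambda>x. \<gamma> x \<inter> ball x (d / 2))"
    using \<open>gauge \<gamma>\<close> \<open>d > 0\<close> by (intro gauge_Int gauge_ball) auto
  then obtain p where p: "p tagged_division_of {a..b}" and "(\<lambda>x. \<gamma> x \<inter> ball x (d / 2)) fine p"
    using fine_division_exists_real by blast
  then have fine: "\<gamma> fine p" "(\<lambda>x. ball x (d / 2)) fine p"
    by (simp_all add: fine_Int)
  have K: "\<exists>u v. K = {u..v} \<and> a \<le> u \<and> u \<le> \<xi> \<and> \<xi> \<le> v \<and> v \<le> b \<and> Inf K = u \<and> Sup K = v \<and> v - u < d"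
    if xK: "(\<xi>, K) \<in> p" for \<xi> K
  proof -
    obtain u v where uv: "K = {u..v}" using tagged_division_ofD(4)[OF p xK] by auto
    have "\<xi> \<in> K" "K \<subseteq> {a..b}" using tagged_division_ofD(2,3)[OF p xK] by auto
    then have *: "a \<le> u" "u \<le> \<xi>" "\<xi> \<le> v" "v \<le> b" "Inf K = u" "Sup K = v" unfolding uv by auto
    have "K \<subseteq> ball \<xi> (d / 2)" using fine(2) xK by (auto simp: fine_def)
    moreover have "u \<in> K" "v \<in> K" using * unfolding uv by simp_all
    ultimately have "u \<in> ball \<xi> (d / 2)" "v \<in> ball \<xi> (d / 2)" by blast+
    then have "v - u < d" using abs_ge_self[of "\<xi> - u"] abs_ge_minus_self[of "\<xi> - v"]
      by (simp add: dist_real_def)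
    with uv * show ?thesis by blast
  qed
  have "norm (\<Sum>(\<xi>, K)\<in>p. (g (Sup K) - g (Inf K)) *\<^sub>R F \<xi>) \<le> (\<Sum>(\<xi>, K)\<in>p. measure lborel K *\<^sub>R \<phi> \<xi>)"
  proof (rule sum_norm_le, clarify)
    fix \<xi> K assume "(\<xi>, K) \<in> p"
    then obtain u v where uv: "K = {u..v}" "a \<le> u" "u \<le> \<xi>" "\<xi> \<le> v" "v \<le> b" "Inf K = u" "Sup K = v"
      using K by blast
    have "norm ((g v - g u) *\<^sub>R F \<xi>) \<le> (L * (v - u)) * norm (F \<xi>)"
      using lipschitz_onD[OF lip, of v u] uv by (simp add: dist_real_def mult_right_mono)
    also have "\<dots> \<le> (v - u) * \<phi> \<xi>"
      using mult_left_mono[OF dom[of \<xi>], of "v - u"] uv by (simp add: ac_simps)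
    finally show "norm ((g (Sup K) - g (Inf K)) *\<^sub>R F \<xi>) \<le> measure lborel K *\<^sub>R \<phi> \<xi>"
      using uv by simp
  qed
  moreover have "norm ((\<Sum>(\<xi>, K)\<in>p. (g (Sup K) - g (Inf K)) *\<^sub>R F \<xi>) - I) < e / 2"
    using d[OF p] K by fastforce
  moreover have "norm ((\<Sum>(\<xi>, K)\<in>p. measure lborel K *\<^sub>R \<phi> \<xi>) - A) < e / 2"
    by (rule \<gamma>[OF p fine(1)])
  moreover have "norm I \<le> norm (\<Sum>(\<xi>, K)\<in>p. (g (Sup K) - g (Inf K)) *\<^sub>R F \<xi>)
      + norm ((\<Sum>(\<xi>, K)\<in>p. (g (Sup K) - g (Inf K)) *\<^sub>R F \<xi>) - I)"
    unfolding norm_minus_commute[of _ I] by (rule norm_triangle_sub)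
  ultimately show "norm I \<le> A + e"
    unfolding real_norm_def by linarith
qed

lemma has_RS_integral_diff:
  assumes "has_RS_integral F g a b I" "has_RS_integral G g a b J"
  shows "has_RS_integral (\<lambda>r. F r - G r) g a b (I - J)"
  unfolding has_RS_integral_def
proof (intro allI impI)
  fix e :: real assume "e > 0"
  then have e: "e / 2 > 0" by simp
  let ?S = "\<lambda>F p. \<Sum>(\<xi>, K)\<in>p. (g (Sup K) - g (Inf K)) *\<^sub>R F \<xi>"
  obtain d1 where d1: "d1 > 0" "\<And>p. \<lbrakk>p tagged_division_of {a..b}; \<forall>(\<xi>, K)\<in>p. Sup K - Inf K < d1\<rbrakk>
      \<Longrightarrow> norm (?S F p - I) < e / 2"
    using assms(1) e unfolding has_RS_integral_def by meson
  obtain d2 where d2: "d2 > 0" "\<And>p. \<lbrakk>p tagged_division_of {a..b}; \<forall>(\<xi>, K)\<in>p. Sup K - Inf K < d2\<rbrakk>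
      \<Longrightarrow> norm (?S G p - J) < e / 2"
    using assms(2) e unfolding has_RS_integral_def by meson
  have "norm (?S (\<lambda>r. F r - G r) p - (I - J)) < e"
    if p: "p tagged_division_of {a..b}" and mesh: "\<forall>(\<xi>, K)\<in>p. Sup K - Inf K < min d1 d2" for p
  proof -
    have "norm (?S F p - I) < e / 2" "norm (?S G p - J) < e / 2"
      using mesh by (fastforce intro!: d1(2)[OF p] d2(2)[OF p])+
    moreover have eq: "?S (\<lambda>r. F r - G r) p - (I - J) = (?S F p - I) - (?S G p - J)"
      by (simp add: split_def scaleR_diff_right sum_subtractf)
    ultimately show ?thesis
      unfolding eq using norm_triangle_ineq4[of "?S F p - I" "?S G p - J"] by linarith
  qed
  then show "\<exists>\<delta>>0. \<forall>p. p tagged_division_of {a..b} \<and> (\<forall>(\<xi>, K)\<in>p. Sup K - Inf K < \<delta>) \<longrightarrow>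
        norm (?S (\<lambda>r. F r - G r) p - (I - J)) < e"
    using d1(1) d2(1) by (intro exI[of _ "min d1 d2"]) simp
qed


section \<open>Integrals of operator-valued functions against vector-valued Lipschitz paths\<close>

lemma norm_column_of_le: "norm (column_of A j) \<le> norm A"
  using norm_blinfun[of A "axis j 1"] by (simp add: column_of_def)

lemma lipschitz_on_component:
  assumes "L-lipschitz_on X x"
  shows "L-lipschitz_on X (\<lambda>s. x s $ j)"
proof (rule lipschitz_onI)
  show "dist (x s $ j) (x t $ j) \<le> L * dist s t" if "s \<in> X" "t \<in> X" for s t
    using dist_vec_nth_le[of "x s" j "x t"] lipschitz_onD[OF assms that] by linarith
qed (rule lipschitz_on_nonneg[OF assms])

lemma continuous_on_column_of:
  assumes "continuous_on X F"
  shows "continuous_on X (\<lambda>s. column_of (F s) j)"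
  unfolding column_of_def by (intro continuous_intros assms)

text \<open>A primitive provides existence, so the definite description in
  \<open>RS_integral\<close> denotes an actual limit of sums.\<close>

lemma has_RS_integral_column:
  assumes "L-lipschitz_on {a..b} x" "continuous_on {a..b} F" "a \<le> b"
  shows "has_RS_integral (\<lambda>s. column_of (F s) j) (\<lambda>s. x s $ j) a b
    (RS_integral (\<lambda>s. column_of (F s) j) (\<lambda>s. x s $ j) a b)"
proof -
  obtain J where J: "\<And>u v. \<lbrakk>a \<le> u; u \<le> v; v \<le> b\<rbrakk>
      \<Longrightarrow> has_RS_integral (\<lambda>s. column_of (F s) j) (\<lambda>s. x s $ j) u v (J v - J u)"
    using RS_primitive_exists[OF lipschitz_on_component[OF assms(1), of j]
        continuous_on_column_of[OF assms(2), of j] assms(3)] by blast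
  have *: "has_RS_integral (\<lambda>s. column_of (F s) j) (\<lambda>s. x s $ j) a b (J b - J a)"
    by (rule J) (use assms(3) in simp_all)
  show ?thesis unfolding RS_integral_eq[OF *] by (rule *)
qed

lemma RS_integrable_vec_continuous:
  assumes "L-lipschitz_on {a..b} x" "continuous_on {a..b} F" "a \<le> b"
  shows "RS_integrable_vec F x a b"
  using has_RS_integral_column[OF assms] unfolding RS_integrable_vec_def RS_integrable_def by blast

text \<open>All three intervals share one primitive in each coordinate, so additivity is the
  telescoping of its increments.\<close>

lemma RS_integral_vec_combine:
  assumes "L-lipschitz_on {a..c} x" "continuous_on {a..c} F" "a \<le> b" "b \<le> c"
  shows "RS_integral_vec F x a c = RS_integral_vec F x a b + RS_integral_vec F x b c"
proof -
  have "RS_integral (\<lambda>s. column_of (F s) j) (\<lambda>s. x s $ j) a c =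
      RS_integral (\<lambda>s. column_of (F s) j) (\<lambda>s. x s $ j) a b
      + RS_integral (\<lambda>s. column_of (F s) j) (\<lambda>s. x s $ j) b c" for j
  proof -
    obtain J where J: "\<And>u v. \<lbrakk>a \<le> u; u \<le> v; v \<le> c\<rbrakk>
        \<Longrightarrow> has_RS_integral (\<lambda>s. column_of (F s) j) (\<lambda>s. x s $ j) u v (J v - J u)"
      using RS_primitive_exists[OF lipschitz_on_component[OF assms(1), of j]
          continuous_on_column_of[OF assms(2), of j] order_trans[OF assms(3,4)]] by blast
    show ?thesis
      using RS_integral_eq[OF J[of a b]] RS_integral_eq[OF J[of b c]] RS_integral_eq[OF J[of a c]]
        assms(3,4) by simp
  qed
  then show ?thesis
    unfolding RS_integral_vec_def by (simp add: sum.distrib)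
qed

lemma RS_integral_vec_diff:
  assumes "L-lipschitz_on {a..b} x" "continuous_on {a..b} F" "continuous_on {a..b} G" "a \<le> b"
  shows "RS_integral_vec (\<lambda>s. F s - G s) x a b = RS_integral_vec F x a b - RS_integral_vec G x a b"
proof -
  have "column_of (F s - G s) j = column_of (F s) j - column_of (G s) j" for s j
    by (simp add: column_of_def blinfun.diff_left)
  then have "RS_integral (\<lambda>s. column_of (F s - G s) j) (\<lambda>s. x s $ j) a b =
      RS_integral (\<lambda>s. column_of (F s) j) (\<lambda>s. x s $ j) a b
      - RS_integral (\<lambda>s. column_of (G s) j) (\<lambda>s. x s $ j) a b" for j
    using RS_integral_eq[OF has_RS_integral_diff[OF has_RS_integral_column[OF assms(1,2,4)]
        has_RS_integral_column[OF assms(1,3,4)]], of j] by simp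
  then show ?thesis
    by (simp add: RS_integral_vec_def sum_subtractf)
qed

text \<open>The factor \<open>CARD('d)\<close> in the domination hypothesis bounds each coordinate
  integral by an equal share of \<open>A\<close>, and the shares add up to \<open>A\<close>.\<close>

lemma norm_RS_integral_vec_le:
  fixes x :: "real \<Rightarrow> real^'d"
  assumes lip: "L-lipschitz_on {a..b} x" and "continuous_on {a..b} F" and "a \<le> b"
    and \<phi>: "(\<phi> has_integral A) {a..b}"
    and dom: "\<And>r. r \<in> {a..b} \<Longrightarrow> real CARD('d) * L * norm (F r) \<le> \<phi> r"
  shows "norm (RS_integral_vec F x a b) \<le> A"
proof -
  define I where "I = (\<lambda>j. RS_integral (\<lambda>s. column_of (F s) j) (\<lambda>s. x s $ j) a b)"
  define n where "n = real CARD('d)"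
  have "n > 0" by (simp add: n_def)
  have "norm (I j) \<le> A / n" for j
    unfolding I_def
  proof (rule has_RS_integral_norm_le[OF has_RS_integral_column[OF assms(1-3)] \<open>a \<le> b\<close> lipschitz_on_component[OF lip]])
    show "((\<lambda>r. \<phi> r / n) has_integral A / n) {a..b}"
      using has_integral_divide[OF \<phi>] .
    fix r assume r: "r \<in> {a..b}"
    have "n * (L * norm (column_of (F r) j)) \<le> n * (L * norm (F r))"
      using \<open>n > 0\<close> lipschitz_on_nonneg[OF lip] norm_column_of_le
      by (intro mult_left_mono) auto
    also have "\<dots> \<le> \<phi> r" using dom[OF r] by (simp add: n_def mult.assoc)
    finally show "L * norm (column_of (F r) j) \<le> \<phi> r / n"
      using \<open>n > 0\<close> by (simp add: field_simps)
  qed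
  then have "norm (RS_integral_vec F x a b) \<le> (\<Sum>j\<in>(UNIV::'d set). A / n)"
    unfolding RS_integral_vec_def I_def by (rule sum_norm_le)
  also have "\<dots> = A" using \<open>n > 0\<close> by (simp add: n_def)
  finally show ?thesis .
qed

section \<open>Hoelder balls and stopped paths\<close>

text \<open>Over times up to \<open>\<delta>\<close> the \<alpha>-bound beats the \<beta>-bound by a
  factor \<open>\<delta> powr (\<alpha> - \<beta>)\<close>; over longer times the uniform bound
  suffices because \<open>(t - s) powr \<beta>\<close> is at least
  \<open>\<delta> powr \<beta>\<close>. As \<open>\<eta>\<close> is independent of \<open>z\<close>,
  uniform convergence inside an \<alpha>-Hoelder ball implies convergence in the
  \<beta>-norm.\<close>

lemma holder_seminorm_interpolation:
  assumes "0 < T" "0 < \<beta>" "\<beta> < \<alpha>" "0 \<le> M" "0 < \<epsilon>"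
  obtains \<eta> where "\<eta> > 0"
    "\<And>z::real \<Rightarrow> 'a::real_normed_vector. (\<And>s t. \<lbrakk>0 \<le> s; s < t; t \<le> T\<rbrakk> \<Longrightarrow> norm (z t - z s) \<le> M * (t - s) powr \<alpha>)
      \<Longrightarrow> (\<And>s t. \<lbrakk>0 \<le> s; s < t; t \<le> T\<rbrakk> \<Longrightarrow> norm (z t - z s) \<le> \<eta>) \<Longrightarrow> holder_seminorm \<beta> T z \<le> \<epsilon>"
proof -
  \<comment> \<open>Chosen so that \<open>M * \<delta> powr (\<alpha> - \<beta>)\<close> is at most
    \<open>\<epsilon>\<close>; the \<open>+ 1\<close> covers \<open>M = 0\<close>.\<close>
  define \<delta> where "\<delta> = (\<epsilon> / (M + 1)) powr (1 / (\<alpha> - \<beta>))"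
  have "\<delta> > 0" using assms by (simp add: \<delta>_def)
  have \<delta>: "\<delta> powr (\<alpha> - \<beta>) = \<epsilon> / (M + 1)" using assms by (simp add: \<delta>_def powr_powr)
  show thesis
  proof (rule that[of "\<epsilon> * \<delta> powr \<beta>"])
    show "\<epsilon> * \<delta> powr \<beta> > 0" using \<open>\<delta> > 0\<close> assms by simp
    fix z :: "real \<Rightarrow> 'a"
    assume M: "\<And>s t. \<lbrakk>0 \<le> s; s < t; t \<le> T\<rbrakk> \<Longrightarrow> norm (z t - z s) \<le> M * (t - s) powr \<alpha>"
      and \<eta>: "\<And>s t. \<lbrakk>0 \<le> s; s < t; t \<le> T\<rbrakk> \<Longrightarrow> norm (z t - z s) \<le> \<epsilon> * \<delta> powr \<beta>"
    show "holder_seminorm \<beta> T z \<le> \<epsilon>"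
    proof (rule holder_seminorm_least(2)[OF \<open>0 < T\<close>])
      fix s t assume st: "0 \<le> s" "s < t" "t \<le> T"
      show "norm (z t - z s) \<le> \<epsilon> * (t - s) powr \<beta>"
      proof (cases "t - s \<le> \<delta>")
        case True
        have "(t - s) powr \<alpha> = (t - s) powr (\<alpha> - \<beta>) * (t - s) powr \<beta>"
          using st by (simp add: powr_add[symmetric])
        also have "\<dots> \<le> \<delta> powr (\<alpha> - \<beta>) * (t - s) powr \<beta>"
          using True st assms by (intro mult_right_mono powr_mono2) auto
        finally have "M * (t - s) powr \<alpha> \<le> (M * \<delta> powr (\<alpha> - \<beta>)) * (t - s) powr \<beta>"
          using assms by (simp add: mult_left_mono mult.assoc)
        also have "\<dots> \<le> \<epsilon> * (t - s) powr \<beta>"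
          using assms by (intro mult_right_mono) (auto simp: \<delta> field_simps)
        finally show ?thesis using M[OF st] by linarith
      next
        case False
        then have "\<delta> powr \<beta> \<le> (t - s) powr \<beta>"
          using \<open>\<delta> > 0\<close> assms by (intro powr_mono2) auto
        then have "\<epsilon> * \<delta> powr \<beta> \<le> \<epsilon> * (t - s) powr \<beta>"
          using assms by (simp add: mult_left_mono)
        then show ?thesis using \<eta>[OF st] by linarith
      qed
    qed
  qed
qed

text \<open>Increment inequalities, rather than a bound on \<open>holder_seminorm\<close>, pass
  directly to pointwise limits, and they force the Hoelder quotients to be bounded.\<close>

definition holder_ball :: "real \<Rightarrow> real \<Rightarrow> real \<Rightarrow> real \<Rightarrow> (real \<Rightarrow> 'a::real_normed_vector) set" where
  "holder_ball \<alpha> T B M = {y \<in> extensional {0..T}. norm (y 0) \<le> B \<and>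
     (\<forall>s t. 0 \<le> s \<longrightarrow> s < t \<longrightarrow> t \<le> T \<longrightarrow> norm (y t - y s) \<le> M * (t - s) powr \<alpha>)}"

lemma holder_ball_subset: "0 < T \<Longrightarrow> holder_ball \<alpha> T B M \<subseteq> holder_space \<alpha> T"
  by (auto simp: holder_ball_def holder_space_def intro!: holder_seminorm_least(1)[where C = M])

lemma holder_space_in_ball:
  assumes "y \<in> holder_space \<alpha> T" "norm (y 0) \<le> B" "holder_seminorm \<alpha> T y \<le> M"
  shows "y \<in> holder_ball \<alpha> T B M"
  using assms holder_seminorm_bound[of \<alpha> T y] mult_right_mono[OF assms(3) powr_ge_zero]
  by (fastforce simp: holder_ball_def holder_space_def intro: order_trans)

text \<open>Arzela-Ascoli extracts a uniformly convergent subsequence, the limit inherits the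
  increment bound, and interpolation upgrades uniform convergence to convergence in the
  \<beta>-norm.\<close>

lemma compactin_holder_ball:
  assumes T: "0 < T" and \<beta>: "0 < \<beta>" "\<beta> < \<alpha>" and M: "0 \<le> M"
  shows "compactin (holder_topology \<alpha> \<beta> T)
    (holder_ball \<alpha> T B M :: (real \<Rightarrow> 'a::euclidean_space) set)"
proof -
  interpret Metric_space "holder_space \<alpha> T" "holder_dist \<beta> T :: (real \<Rightarrow> 'a) \<Rightarrow> _"
    by (rule Metric_space_holder) (use assms in auto)
  show ?thesis
    unfolding holder_topology_def compactin_sequentially
  proof (intro conjI allI impI)
    show "(holder_ball \<alpha> T B M :: (real \<Rightarrow> 'a) set) \<subseteq> holder_space \<alpha> T"
      by (rule holder_ball_subset[OF T])
    fix \<sigma> :: "nat \<Rightarrow> real \<Rightarrow> 'a"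
    assume "range \<sigma> \<subseteq> holder_ball \<alpha> T B M"
    then have \<sigma>: "\<sigma> n \<in> holder_ball \<alpha> T B M" for n by blast
    have inc: "norm (\<sigma> n t - \<sigma> n s) \<le> M * \<bar>t - s\<bar> powr \<alpha>" if "s \<in> {0..T}" "t \<in> {0..T}" for n s t
    proof (cases s t rule: linorder_cases)
      case less
      then show ?thesis using \<sigma>[of n] that by (simp add: holder_ball_def)
    next
      case greater
      then show ?thesis
        using \<sigma>[of n] that by (simp add: holder_ball_def norm_minus_commute[of "\<sigma> n t"])
    qed simp
    obtain g k where k: "strict_mono (k :: nat \<Rightarrow> nat)"
      and lim: "\<And>e. 0 < e \<Longrightarrow> \<exists>N. \<forall>n t. n \<ge> N \<and> t \<in> {0..T} \<longrightarrow> norm (\<sigma> (k n) t - g t) < e"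
    proof (rule Arzela_Ascoli[of "{0..T}" \<sigma> "B + M * T powr \<alpha>"])
      fix n t assume t: "t \<in> {0..T}"
      have "norm (\<sigma> n t) \<le> norm (\<sigma> n 0) + norm (\<sigma> n t - \<sigma> n 0)"
        by (metis norm_triangle_sub)
      also have "\<dots> \<le> B + M * t powr \<alpha>"
        using inc[of 0 t n] \<sigma>[of n] t T by (intro add_mono) (auto simp: holder_ball_def)
      also have "\<dots> \<le> B + M * T powr \<alpha>"
        using t \<beta> M by (intro add_left_mono mult_left_mono powr_mono2) auto
      finally show "norm (\<sigma> n t) \<le> B + M * T powr \<alpha>" .
    next
      fix t e :: real assume t: "t \<in> {0..T}" and "0 < e"
      \<comment> \<open>Makes \<open>M * d powr \<alpha>\<close> smaller than \<open>e\<close>,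
        which is equicontinuity with one modulus for the whole ball.\<close>
      define d where "d = (e / (M + 1)) powr (1 / \<alpha>)"
      have "d > 0" using \<open>e > 0\<close> M by (simp add: d_def)
      have d: "d powr \<alpha> = e / (M + 1)" using \<beta> \<open>e > 0\<close> M by (simp add: d_def powr_powr)
      have "norm (\<sigma> n t - \<sigma> n s) < e" if s: "s \<in> {0..T}" "norm (t - s) < d" for n s
      proof -
        have "\<bar>t - s\<bar> powr \<alpha> \<le> d powr \<alpha>" using s \<beta> by (intro powr_mono2) auto
        then have "M * \<bar>t - s\<bar> powr \<alpha> \<le> M * (e / (M + 1))"
          unfolding d using M by (rule mult_left_mono)
        also have "\<dots> < e" using M \<open>e > 0\<close> by (simp add: field_simps)
        finally show ?thesis using inc[OF s(1) t, of n] by linarith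
      qed
      then show "\<exists>d>0. \<forall>n s. s \<in> {0..T} \<and> norm (t - s) < d \<longrightarrow> norm (\<sigma> n t - \<sigma> n s) < e"
        using \<open>d > 0\<close> by blast
    qed auto
    \<comment> \<open>Members of the path space are extensional, whereas \<open>g\<close> is
      uncontrolled outside \<open>[0,T]\<close>.\<close>
    define l where "l = restrict g {0..T}"
    have pointwise: "(\<lambda>n. \<sigma> (k n) t) \<longlonglongrightarrow> l t" if "t \<in> {0..T}" for t
      unfolding LIMSEQ_def dist_norm l_def using lim that by (metis restrict_apply')
    have l: "l \<in> holder_ball \<alpha> T B M"
      unfolding holder_ball_def
    proof (safe)
      show "l \<in> extensional {0..T}" by (simp add: l_def)
      show "norm (l 0) \<le> B"
        using \<sigma> T by (intro LIMSEQ_le_const2[OF tendsto_norm[OF pointwise]]) (auto simp: holder_ball_def)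
      fix s t assume st: "0 \<le> s" "s < t" "t \<le> T"
      show "norm (l t - l s) \<le> M * (t - s) powr \<alpha>"
        using inc[of s t] st
        by (intro LIMSEQ_le_const2[OF tendsto_norm[OF tendsto_diff[OF pointwise pointwise]]]) auto
    qed
    have "limitin mtopology (\<sigma> \<circ> k) l sequentially"
      unfolding limitin_metric
    proof (intro conjI allI impI)
      show l': "l \<in> holder_space \<alpha> T" using l holder_ball_subset[OF T] by blast
      fix \<epsilon> :: real assume "\<epsilon> > 0"
      \<comment> \<open>The difference of two members of the ball has increments up to
        \<open>2 * M * (t - s) powr \<alpha>\<close>, hence the constant
        \<open>2 * M\<close>.\<close>
      then obtain \<eta> where "\<eta> > 0" and \<eta>: "\<And>z::real \<Rightarrow> 'a.
          (\<And>s t. \<lbrakk>0 \<le> s; s < t; t \<le> T\<rbrakk> \<Longrightarrow> norm (z t - z s) \<le> (2 * M) * (t - s) powr \<alpha>)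
          \<Longrightarrow> (\<And>s t. \<lbrakk>0 \<le> s; s < t; t \<le> T\<rbrakk> \<Longrightarrow> norm (z t - z s) \<le> \<eta>)
          \<Longrightarrow> holder_seminorm \<beta> T z \<le> \<epsilon> / 3"
        using holder_seminorm_interpolation[OF T \<beta>, of "2 * M" "\<epsilon> / 3"] M
        by (metis divide_pos_pos mult_nonneg_nonneg zero_le_numeral zero_less_numeral)
      \<comment> \<open>An error of \<open>\<eta> / 2\<close> at each endpoint bounds an increment
        of the difference by \<open>\<eta>\<close>; the other entry bounds the distance of the
        initial values.\<close>
      have "min (\<epsilon> / 3) (\<eta> / 2) > 0" using \<open>\<epsilon> > 0\<close> \<open>\<eta> > 0\<close> by simp
      then obtain N where N: "\<And>n t. \<lbrakk>n \<ge> N; t \<in> {0..T}\<rbrakk> \<Longrightarrow> norm (\<sigma> (k n) t - l t) < min (\<epsilon> / 3) (\<eta> / 2)"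
        using lim unfolding l_def by (metis restrict_apply')
      have "(\<sigma> \<circ> k) n \<in> holder_space \<alpha> T \<and> holder_dist \<beta> T ((\<sigma> \<circ> k) n) l < \<epsilon>" if n: "n \<ge> N" for n
      proof
        show "(\<sigma> \<circ> k) n \<in> holder_space \<alpha> T"
          using \<sigma> holder_ball_subset[OF T] by fastforce
        have "holder_seminorm \<beta> T (\<lambda>r. \<sigma> (k n) r - l r) \<le> \<epsilon> / 3"
        proof (rule \<eta>)
          fix s t assume st: "0 \<le> s" "s < t" "t \<le> T"
          have "norm ((\<sigma> (k n) t - l t) - (\<sigma> (k n) s - l s))
              \<le> norm (\<sigma> (k n) t - \<sigma> (k n) s) + norm (l t - l s)"
            using norm_triangle_ineq4[of "\<sigma> (k n) t - \<sigma> (k n) s" "l t - l s"] by (simp add: algebra_simps)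
          also have "\<dots> \<le> M * (t - s) powr \<alpha> + M * (t - s) powr \<alpha>"
            using l \<sigma>[of "k n"] st by (intro add_mono) (auto simp: holder_ball_def)
          finally show "norm ((\<sigma> (k n) t - l t) - (\<sigma> (k n) s - l s)) \<le> (2 * M) * (t - s) powr \<alpha>" by simp
          show "norm ((\<sigma> (k n) t - l t) - (\<sigma> (k n) s - l s)) \<le> \<eta>"
            using N[OF n, of t] N[OF n, of s] st
              norm_triangle_ineq4[of "\<sigma> (k n) t - l t" "\<sigma> (k n) s - l s"] by auto
        qed
        then show "holder_dist \<beta> T ((\<sigma> \<circ> k) n) l < \<epsilon>"
          using N[OF n, of 0] T \<open>\<epsilon> > 0\<close> by (auto simp: holder_dist_def holder_norm_def)
      qed
      then show "\<forall>\<^sub>F n in sequentially. (\<sigma> \<circ> k) n \<in> holder_space \<alpha> T \<and> holder_dist \<beta> T ((\<sigma> \<circ> k) n) l < \<epsilon>"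
        unfolding eventually_sequentially by blast
    qed
    then show "\<exists>l r. l \<in> holder_ball \<alpha> T B M \<and> strict_mono r \<and> limitin mtopology (\<sigma> \<circ> r) l sequentially"
      using l k by blast
  qed
qed

text \<open>Two stoppings of one path differ by a path with \<alpha>-Hoelder constant at most
  \<open>2 * M\<close>, and its increments are uniformly small when the stopping times are close.
  Interpolation turns this into a small \<beta>-seminorm.\<close>

lemma continuous_map_stopped:
  fixes y :: "real \<Rightarrow> 'a::euclidean_space"
  assumes T: "0 < T" and \<beta>: "0 < \<beta>" "\<beta> < \<alpha>" and y: "y \<in> holder_space \<alpha> T"
  shows "continuous_map (top_of_set {0..T}) (stopped_topology \<alpha> \<beta> T) (\<lambda>t. (t, stopped T t y))"
proof -
  interpret Metric_space "stopped_paths \<alpha> T" "stopped_dist \<beta> T :: _ \<Rightarrow> real \<times> (real \<Rightarrow> 'a) \<Rightarrow> _"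
    by (rule Metric_space_stopped) (use assms in auto)
  define M where "M = holder_seminorm \<alpha> T y"
  have "M \<ge> 0" using holder_seminorm_nonneg[OF T] by (simp add: M_def)
  have inc: "norm (y t - y s) \<le> M * \<bar>t - s\<bar> powr \<alpha>" if "s \<in> {0..T}" "t \<in> {0..T}" for s t
  proof (cases s t rule: linorder_cases)
    case less
    then show ?thesis
      using holder_seminorm_bound[of \<alpha> T y s t] y that by (simp add: holder_space_def M_def)
  next
    case greater
    then show ?thesis
      using holder_seminorm_bound[of \<alpha> T y t s] y that
      by (simp add: holder_space_def M_def norm_minus_commute[of "y t"])
  qed simp
  show ?thesis
    unfolding stopped_topology_def continuous_map_to_metric
  proof (intro ballI allI impI)
    fix t \<epsilon> :: real assume "t \<in> topspace (top_of_set {0..T})" and "\<epsilon> > 0"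
    then have t: "t \<in> {0..T}" by simp
    obtain \<eta> where "\<eta> > 0" and \<eta>: "\<And>z::real \<Rightarrow> 'a.
        (\<And>s t. \<lbrakk>0 \<le> s; s < t; t \<le> T\<rbrakk> \<Longrightarrow> norm (z t - z s) \<le> (2 * M) * (t - s) powr \<alpha>)
        \<Longrightarrow> (\<And>s t. \<lbrakk>0 \<le> s; s < t; t \<le> T\<rbrakk> \<Longrightarrow> norm (z t - z s) \<le> \<eta>)
        \<Longrightarrow> holder_seminorm \<beta> T z \<le> \<epsilon> / 3"
      using holder_seminorm_interpolation[OF T \<beta>, of "2 * M" "\<epsilon> / 3"] \<open>M \<ge> 0\<close> \<open>\<epsilon> > 0\<close>
      by (metis divide_pos_pos mult_nonneg_nonneg zero_le_numeral zero_less_numeral)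
    \<comment> \<open>The first entry controls the time component of the distance; the second makes
      \<open>2 * M * \<delta> powr \<alpha>\<close> at most \<open>\<eta>\<close>.\<close>
    define \<delta> where "\<delta> = min (\<epsilon> / 3) ((\<eta> / (2 * M + 1)) powr (1 / \<alpha>))"
    have "\<delta> > 0" using \<open>\<epsilon> > 0\<close> \<open>\<eta> > 0\<close> \<open>M \<ge> 0\<close> by (simp add: \<delta>_def)
    have "\<delta> powr \<alpha> \<le> ((\<eta> / (2 * M + 1)) powr (1 / \<alpha>)) powr \<alpha>"
      using \<beta> \<open>\<delta> > 0\<close> by (intro powr_mono2) (auto simp: \<delta>_def)
    also have "\<dots> = \<eta> / (2 * M + 1)"
      using \<beta> \<open>\<eta> > 0\<close> \<open>M \<ge> 0\<close> by (simp add: powr_powr)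
    finally have "2 * M * \<delta> powr \<alpha> \<le> 2 * M * (\<eta> / (2 * M + 1))"
      using \<open>M \<ge> 0\<close> by (intro mult_left_mono) auto
    also have "\<dots> \<le> \<eta>" using \<open>M \<ge> 0\<close> \<open>\<eta> > 0\<close> by (simp add: field_simps)
    finally have \<delta>: "2 * M * \<delta> powr \<alpha> \<le> \<eta>" .
    have "stopped_dist \<beta> T (t, stopped T t y) (s, stopped T s y) < \<epsilon>"
      if s: "s \<in> {0..T}" "\<bar>t - s\<bar> < \<delta>" for s
    proof -
      have "holder_seminorm \<beta> T (\<lambda>r. stopped T t y r - stopped T s y r) \<le> \<epsilon> / 3"
      proof (rule \<eta>)
        fix p q assume pq: "0 \<le> p" "p < q" "q \<le> T"
        define D where "D = (stopped T t y q - stopped T s y q) - (stopped T t y p - stopped T s y p)"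
        \<comment> \<open>Grouping by stopping time exposes two increments over
          \<open>[p,q]\<close>, for the Hoelder bound. Grouping by evaluation time exposes two
          changes of size at most \<open>M * \<delta> powr \<alpha>\<close>, for the uniform
          bound.\<close>
        have D1: "D = (y (min q t) - y (min p t)) - (y (min q s) - y (min p s))"
          and D2: "D = (y (min q t) - y (min q s)) - (y (min p t) - y (min p s))"
          using pq by (simp_all add: D_def stopped_def)
        have *: "norm (y (min q r) - y (min p r)) \<le> M * (q - p) powr \<alpha>" if "r \<in> {0..T}" for r
        proof -
          have "norm (y (min q r) - y (min p r)) \<le> M * \<bar>min q r - min p r\<bar> powr \<alpha>"
            using pq that by (intro inc) auto
          also have "\<dots> \<le> M * (q - p) powr \<alpha>"
            using \<open>M \<ge> 0\<close> \<beta> pq by (intro mult_left_mono powr_mono2) auto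
          finally show ?thesis .
        qed
        show "norm D \<le> (2 * M) * (q - p) powr \<alpha>"
          unfolding D1 using norm_triangle_ineq4[of "y (min q t) - y (min p t)" "y (min q s) - y (min p s)"]
            *[OF t] *[OF s(1)] by linarith
        have **: "norm (y (min r t) - y (min r s)) \<le> M * \<delta> powr \<alpha>" if "r \<in> {0..T}" for r
        proof -
          have "norm (y (min r t) - y (min r s)) \<le> M * \<bar>min r t - min r s\<bar> powr \<alpha>"
            using s t that by (intro inc) auto
          also have "\<dots> \<le> M * \<delta> powr \<alpha>"
            using \<open>M \<ge> 0\<close> \<beta> s by (intro mult_left_mono powr_mono2) auto
          finally show ?thesis .
        qed
        show "norm D \<le> \<eta>"
          unfolding D2 using norm_triangle_ineq4[of "y (min q t) - y (min q s)" "y (min p t) - y (min p s)"]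
            **[of q] **[of p] pq \<delta> by simp
      qed
      moreover have "\<bar>t - s\<bar> < \<epsilon> / 3" using s by (simp add: \<delta>_def)
      ultimately show ?thesis
        using t s T \<open>\<epsilon> > 0\<close> by (simp add: stopped_dist_def stopped_def)
    qed
    moreover have "(s, stopped T s y) \<in> stopped_paths \<alpha> T" if "s \<in> {0..T}" for s
      using that y by (auto simp: stopped_paths_def)
    ultimately have "\<forall>s\<in>{0..T} \<inter> ball t \<delta>. (s, stopped T s y) \<in> mball (t, stopped T t y) \<epsilon>"
      using t by (auto simp: dist_real_def)
    then show "\<exists>U. openin (top_of_set {0..T}) U \<and> t \<in> U \<and> (\<forall>s\<in>U. (s, stopped T s y) \<in> mball (t, stopped T t y) \<epsilon>)"
      using t \<open>\<delta> > 0\<close> by (intro exI[of _ "{0..T} \<inter> ball t \<delta>"]) auto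
  qed
qed

text \<open>Stopping at \<open>\<tau>\<close> shortens each increment to the part before
  \<open>\<tau>\<close>, so a Hoelder bound up to \<open>\<tau>\<close> controls the seminorm on
  \<open>[0,T]\<close>. The separate \<open>z'\<close> covers both a stopped path and a difference
  of two stopped paths.\<close>

lemma holder_seminorm_stopped_le:
  assumes "0 < T" "0 \<le> \<gamma>" "0 \<le> C" "0 \<le> \<tau>"
    and inc: "\<And>s t. \<lbrakk>0 \<le> s; s < t; t \<le> \<tau>; t \<le> T\<rbrakk> \<Longrightarrow> norm (z t - z s) \<le> C * (t - s) powr \<gamma>"
    and z': "\<And>r. r \<in> {0..T} \<Longrightarrow> z' r = z (min r \<tau>)"
  shows "holder_seminorm \<gamma> T z' \<le> C"
proof (rule holder_seminorm_least(2)[OF \<open>0 < T\<close>])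
  fix s t assume st: "0 \<le> s" "s < t" "t \<le> T"
  show "norm (z' t - z' s) \<le> C * (t - s) powr \<gamma>"
  proof (cases "s < \<tau>")
    case True
    then have "norm (z (min t \<tau>) - z (min s \<tau>)) \<le> C * (min t \<tau> - min s \<tau>) powr \<gamma>"
      using st assms by (intro inc) auto
    also have "\<dots> \<le> C * (t - s) powr \<gamma>"
      using True st assms by (intro mult_left_mono powr_mono2) auto
    finally show ?thesis using st by (simp add: z')
  next
    case False
    then have "min t \<tau> = min s \<tau>" using st by simp
    then show ?thesis using st \<open>0 \<le> C\<close> by (simp add: z')
  qed
qed

section \<open>Exponentially weighted increments\<close>

text \<open>Lipschitz continuity with respect to the clock \<open>exp (\<mu> * t)\<close>, an
  incremental form of the Bielecki weight. Bounding increments rather than values gives access to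
  Hoelder seminorms.\<close>

definition exp_lipschitz :: "real \<Rightarrow> real \<Rightarrow> real \<Rightarrow> (real \<Rightarrow> 'a::real_normed_vector) \<Rightarrow> bool" where
  "exp_lipschitz \<mu> T \<rho> z \<longleftrightarrow>
     (\<forall>s t. 0 \<le> s \<longrightarrow> s \<le> t \<longrightarrow> t \<le> T \<longrightarrow> norm (z t - z s) \<le> \<rho> * (exp (\<mu> * t) - exp (\<mu> * s)))"

lemma exp_lipschitzD:
  "\<lbrakk>exp_lipschitz \<mu> T \<rho> z; 0 \<le> s; s \<le> t; t \<le> T\<rbrakk>
    \<Longrightarrow> norm (z t - z s) \<le> \<rho> * (exp (\<mu> * t) - exp (\<mu> * s))"
  by (simp add: exp_lipschitz_def)

text \<open>Once the exponential at \<open>s\<close> is factored out, both factors increase with the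
  rate. This transfers increment bounds from rate \<open>\<kappa>\<close> to a larger rate
  \<open>\<mu>\<close>.\<close>

lemma exp_diff_mono:
  fixes \<kappa> \<mu> s t :: real
  assumes "0 \<le> \<kappa>" "\<kappa> \<le> \<mu>" "0 \<le> s" "s \<le> t"
  shows "exp (\<kappa> * t) - exp (\<kappa> * s) \<le> exp (\<mu> * t) - exp (\<mu> * s)"
proof -
  have "exp (\<kappa> * t) - exp (\<kappa> * s) = exp (\<kappa> * s) * (exp (\<kappa> * (t - s)) - 1)"
    by (simp add: algebra_simps flip: exp_add)
  also have "\<dots> \<le> exp (\<mu> * s) * (exp (\<mu> * (t - s)) - 1)"
    using assms by (intro mult_mono) (auto intro: mult_right_mono)
  also have "\<dots> = exp (\<mu> * t) - exp (\<mu> * s)"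
    by (simp add: algebra_simps flip: exp_add)
  finally show ?thesis .
qed

text \<open>The exponent \<open>\<beta> < 1\<close> of \<open>\<mu>\<close> is what makes the solution map contracting for large \<open>\<mu>\<close>.\<close>

lemma exp_diff_le_powr:
  fixes \<mu> s t \<beta> :: real
  assumes "0 < \<mu>" "s < t" "0 \<le> \<beta>" "\<beta> \<le> 1"
  shows "exp (\<mu> * t) - exp (\<mu> * s) \<le> exp (\<mu> * t) * \<mu> powr \<beta> * (t - s) powr \<beta>"
proof -
  define x where "x = \<mu> * (t - s)"
  have "x > 0" using assms by (simp add: x_def)
  \<comment> \<open>The left side is at most \<open>x\<close> and at most \<open>1\<close>; the
    smaller of the two is below \<open>x powr \<beta>\<close> on either side of
    \<open>x = 1\<close>.\<close>
  have "1 - exp (- x) \<le> x powr \<beta>"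
  proof (cases "x \<le> 1")
    case True
    have "1 - exp (- x) \<le> x" using exp_ge_add_one_self[of "- x"] by simp
    also have "x = x powr 1" using \<open>x > 0\<close> by simp
    also have "\<dots> \<le> x powr \<beta>" using True \<open>x > 0\<close> assms by (intro powr_mono') auto
    finally show ?thesis .
  next
    case False
    then have "1 \<le> x powr \<beta>" using assms by (intro ge_one_powr_ge_zero) auto
    then show ?thesis using exp_gt_zero[of "- x"] by linarith
  qed
  then have "exp (\<mu> * t) * (1 - exp (- x)) \<le> exp (\<mu> * t) * x powr \<beta>"
    by (intro mult_left_mono) auto
  moreover have "exp (\<mu> * t) * (1 - exp (- x)) = exp (\<mu> * t) - exp (\<mu> * s)"
    by (simp add: x_def algebra_simps flip: exp_add)
  moreover have "x powr \<beta> = \<mu> powr \<beta> * (t - s) powr \<beta>"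
    using assms by (simp add: x_def powr_mult)
  ultimately show ?thesis by (simp add: mult.assoc)
qed

text \<open>Evaluating the weight at \<open>\<tau>\<close> gives one \<beta>-Hoelder constant for
  all increments up to \<open>\<tau>\<close>, as needed for the path stopped there. The conversion
  costs a factor \<open>\<mu> powr \<beta>\<close>.\<close>

lemma exp_lipschitz_holder:
  assumes "exp_lipschitz \<mu> T \<rho> z" "0 \<le> \<rho>" "0 < \<mu>" "0 \<le> \<beta>" "\<beta> \<le> 1"
    and "0 \<le> s" "s < t" "t \<le> \<tau>" "t \<le> T"
  shows "norm (z t - z s) \<le> \<rho> * exp (\<mu> * \<tau>) * \<mu> powr \<beta> * (t - s) powr \<beta>"
proof -
  have "norm (z t - z s) \<le> \<rho> * (exp (\<mu> * t) - exp (\<mu> * s))"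
    using assms by (intro exp_lipschitzD[OF assms(1)]) auto
  also have "\<dots> \<le> \<rho> * (exp (\<mu> * t) * \<mu> powr \<beta> * (t - s) powr \<beta>)"
    using assms by (intro mult_left_mono exp_diff_le_powr) auto
  also have "\<dots> \<le> \<rho> * (exp (\<mu> * \<tau>) * \<mu> powr \<beta> * (t - s) powr \<beta>)"
    using assms by (intro mult_left_mono mult_right_mono) auto
  finally show ?thesis by (simp add: mult.assoc)
qed

text \<open>Source of the factor \<open>1 / \<mu>\<close> gained by integration.\<close>

lemma has_integral_exp_scaled:
  fixes \<mu> s t c :: real
  assumes "\<mu> \<noteq> 0" "s \<le> t"
  shows "((\<lambda>r. c * exp (\<mu> * r)) has_integral c / \<mu> * (exp (\<mu> * t) - exp (\<mu> * s))) {s..t}"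
proof -
  have "((\<lambda>r. c / \<mu> * exp (\<mu> * r)) has_vector_derivative c * exp (\<mu> * r)) (at r within {s..t})" for r
    using assms by (auto intro!: derivative_eq_intros simp flip: has_real_derivative_iff_has_vector_derivative)
  from fundamental_theorem_of_calculus[OF assms(2) this] show ?thesis
    by (simp add: algebra_simps)
qed

section \<open>Sums, limits and geometric series of weighted increment bounds\<close>

lemma exp_lipschitzI:
  "(\<And>s t. \<lbrakk>0 \<le> s; s \<le> t; t \<le> T\<rbrakk> \<Longrightarrow> norm (z t - z s) \<le> \<rho> * (exp (\<mu> * t) - exp (\<mu> * s)))
    \<Longrightarrow> exp_lipschitz \<mu> T \<rho> z"
  by (simp add: exp_lipschitz_def)

lemma exp_lipschitz_mono:
  assumes "exp_lipschitz \<mu> T \<rho> z" "\<rho> \<le> \<rho>'" "0 \<le> \<mu>"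
  shows "exp_lipschitz \<mu> T \<rho>' z"
proof (rule exp_lipschitzI)
  fix s t assume st: "0 \<le> s" "s \<le> t" "t \<le> T"
  then have "\<rho> * (exp (\<mu> * t) - exp (\<mu> * s)) \<le> \<rho>' * (exp (\<mu> * t) - exp (\<mu> * s))"
    using assms by (intro mult_right_mono) (auto intro: mult_left_mono)
  then show "norm (z t - z s) \<le> \<rho>' * (exp (\<mu> * t) - exp (\<mu> * s))"
    using exp_lipschitzD[OF assms(1) st] by linarith
qed

lemma exp_lipschitz_add:
  assumes "exp_lipschitz \<mu> T \<rho> u" "exp_lipschitz \<mu> T \<rho>' v"
  shows "exp_lipschitz \<mu> T (\<rho> + \<rho>') (\<lambda>t. u t + v t)"
proof (rule exp_lipschitzI)
  fix s t assume st: "0 \<le> s" "s \<le> t" "t \<le> T"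
  have "norm ((u t - u s) + (v t - v s)) \<le> (\<rho> + \<rho>') * (exp (\<mu> * t) - exp (\<mu> * s))"
    using norm_triangle_ineq[of "u t - u s" "v t - v s"]
      exp_lipschitzD[OF assms(1) st] exp_lipschitzD[OF assms(2) st] by (simp only: distrib_right)
  then show "norm (u t + v t - (u s + v s)) \<le> (\<rho> + \<rho>') * (exp (\<mu> * t) - exp (\<mu> * s))"
    by (simp only: add_diff_add)
qed

lemma exp_lipschitz_minus_commute:
  "exp_lipschitz \<mu> T \<rho> (\<lambda>t. u t - v t) \<longleftrightarrow> exp_lipschitz \<mu> T \<rho> (\<lambda>t. v t - u t)"
proof -
  have "norm (u t - v t - (u s - v s)) = norm (v t - u t - (v s - u s))" for s t
    by (metis minus_diff_eq norm_minus_commute minus_diff_minus)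
  then show ?thesis by (simp add: exp_lipschitz_def)
qed

lemma exp_lipschitz_LIMSEQ:
  assumes "\<And>t. t \<in> {0..T} \<Longrightarrow> (\<lambda>n. u n t) \<longlonglongrightarrow> v t"
    and "\<forall>\<^sub>F n in sequentially. exp_lipschitz \<mu> T \<rho> (u n)"
  shows "exp_lipschitz \<mu> T \<rho> v"
proof (rule exp_lipschitzI)
  fix s t assume st: "0 \<le> s" "s \<le> t" "t \<le> T"
  have "(\<lambda>n. norm (u n t - u n s)) \<longlonglongrightarrow> norm (v t - v s)"
    using st by (intro tendsto_intros assms(1)) auto
  moreover have "\<forall>\<^sub>F n in sequentially. norm (u n t - u n s) \<le> \<rho> * (exp (\<mu> * t) - exp (\<mu> * s))"
    using assms(2) by eventually_elim (rule exp_lipschitzD[OF _ st])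
  ultimately show "norm (v t - v s) \<le> \<rho> * (exp (\<mu> * t) - exp (\<mu> * s))"
    by (rule tendsto_upperbound) simp
qed

lemma exp_lipschitz_eq_zero:
  assumes "\<And>n::nat. exp_lipschitz \<mu> T (R / 2 ^ n) z" "z 0 = 0" "t \<in> {0..T}"
  shows "z t = 0"
proof -
  have "(\<lambda>n. R / 2 ^ n * (exp (\<mu> * t) - 1)) \<longlonglongrightarrow> 0 * (exp (\<mu> * t) - 1)"
    using LIMSEQ_divide_realpow_zero[of 2 R] by (intro tendsto_intros) auto
  moreover have "norm (z t) \<le> R / 2 ^ n * (exp (\<mu> * t) - 1)" for n
    using exp_lipschitzD[OF assms(1)[of n], of 0 t] assms(2,3) by simp
  ultimately have "norm (z t) \<le> 0"
    by (intro LIMSEQ_le_const) auto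
  then show ?thesis by simp
qed

text \<open>Geometrically shrinking steps are summable at each time, which gives a pointwise limit;
  the tail of the series bounds the distance to it in the same weighted sense.\<close>

lemma exp_lipschitz_geometric_limit:
  fixes Y :: "nat \<Rightarrow> real \<Rightarrow> 'a::banach"
  assumes step: "\<And>n. exp_lipschitz \<mu> T (R / 2 ^ n) (\<lambda>t. Y (Suc n) t - Y n t)"
    and init: "\<And>n. Y n 0 = a" and "0 \<le> R" "0 \<le> \<mu>"
  obtains y where "y \<in> extensional {0..T}"
    and "\<And>t. t \<in> {0..T} \<Longrightarrow> (\<lambda>n. Y n t) \<longlonglongrightarrow> y t"
    and "\<And>n. exp_lipschitz \<mu> T (2 * R / 2 ^ n) (\<lambda>t. y t - Y n t)"
proof -
  have conv: "convergent (\<lambda>n. Y n t)" if t: "t \<in> {0..T}" for t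
  proof -
    have geometric: "norm (Y (Suc n) t - Y n t) \<le> R * exp (\<mu> * t) * (1 / 2) ^ n" for n
    proof -
      have "norm (Y (Suc n) t - Y n t) \<le> R / 2 ^ n * (exp (\<mu> * t) - 1)"
        using exp_lipschitzD[OF step[of n], of 0 t] t init by simp
      also have "\<dots> \<le> R / 2 ^ n * exp (\<mu> * t)"
        using \<open>0 \<le> R\<close> by (intro mult_left_mono) auto
      finally show ?thesis by (simp add: power_divide)
    qed
    have "summable (\<lambda>n. R * exp (\<mu> * t) * (1 / 2) ^ n)"
      by (intro summable_mult summable_geometric) simp
    then have "summable (\<lambda>n. Y (Suc n) t - Y n t)"
      by (rule summable_comparison_test'[where N = 0]) (rule geometric)
    then have "convergent (\<lambda>n. Y n t - Y 0 t)"
      unfolding summable_iff_convergent sum_lessThan_telescope[of "\<lambda>n. Y n t"] .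
    then show ?thesis
      using convergent_add[OF _ convergent_const, of "\<lambda>n. Y n t - Y 0 t" "Y 0 t"] by simp
  qed
  define y where "y = (\<lambda>t\<in>{0..T}. lim (\<lambda>n. Y n t))"
  have lim: "(\<lambda>n. Y n t) \<longlonglongrightarrow> y t" if "t \<in> {0..T}" for t
    using conv[OF that] that by (simp add: y_def convergent_LIMSEQ_iff)
  \<comment> \<open>The exact partial geometric sum makes the induction close: the subtracted term
    leaves room for the next step.\<close>
  have partial: "exp_lipschitz \<mu> T (2 * R / 2 ^ n - 2 * R / 2 ^ m) (\<lambda>t. Y m t - Y n t)" if "n \<le> m" for n m
    using that
  proof (induction m rule: dec_induct)
    case base
    then show ?case by (simp add: exp_lipschitz_def)
  next
    case (step m)
    have "2 * R / 2 ^ n - 2 * R / 2 ^ Suc m = R / 2 ^ m + (2 * R / 2 ^ n - 2 * R / 2 ^ m)"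
      by simp
    then show ?case
      using exp_lipschitz_add[OF assms(1)[of m] step.IH] by simp
  qed
  have "exp_lipschitz \<mu> T (2 * R / 2 ^ n) (\<lambda>t. y t - Y n t)" for n
  proof (rule exp_lipschitz_LIMSEQ)
    show "(\<lambda>m. Y m t - Y n t) \<longlonglongrightarrow> y t - Y n t" if "t \<in> {0..T}" for t
      by (intro tendsto_intros lim that)
    have "exp_lipschitz \<mu> T (2 * R / 2 ^ n) (\<lambda>t. Y m t - Y n t)" if "n \<le> m" for m
      using partial[OF that] by (rule exp_lipschitz_mono) (use \<open>0 \<le> R\<close> \<open>0 \<le> \<mu>\<close> in auto)
    then show "\<forall>\<^sub>F m in sequentially. exp_lipschitz \<mu> T (2 * R / 2 ^ n) (\<lambda>t. Y m t - Y n t)"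
      unfolding eventually_sequentially by blast
  qed
  then show thesis
    using that[of y] lim by (simp add: y_def)
qed

text \<open>As \<open>\<beta> < 1\<close>, the quotient \<open>\<mu> powr \<beta> / \<mu>\<close>
  tends to zero. The witness makes \<open>\<mu> powr (1 - \<beta>)\<close> at least
  \<open>2 * A + 1\<close>, where the \<open>+ 1\<close> keeps the witness positive.\<close>

lemma powr_div_eventually_le:
  fixes A \<beta> :: real
  assumes "0 \<le> A" "\<beta> < 1"
  obtains \<mu>\<^sub>0 where "\<mu>\<^sub>0 > 0" "\<And>\<mu>. \<mu> \<ge> \<mu>\<^sub>0 \<Longrightarrow> A * \<mu> powr \<beta> / \<mu> \<le> 1 / 2"
proof
  define \<mu>\<^sub>0 where "\<mu>\<^sub>0 = (2 * A + 1) powr (1 / (1 - \<beta>))"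
  show "\<mu>\<^sub>0 > 0" using assms by (simp add: \<mu>\<^sub>0_def)
  fix \<mu> assume "\<mu> \<ge> \<mu>\<^sub>0"
  with \<open>\<mu>\<^sub>0 > 0\<close> have "\<mu> > 0" by simp
  have "2 * A + 1 = \<mu>\<^sub>0 powr (1 - \<beta>)" using assms by (simp add: \<mu>\<^sub>0_def powr_powr)
  also have "\<dots> \<le> \<mu> powr (1 - \<beta>)"
    using \<open>\<mu> \<ge> \<mu>\<^sub>0\<close> \<open>\<mu>\<^sub>0 > 0\<close> assms by (intro powr_mono2) auto
  finally have "2 * A * \<mu> powr \<beta> \<le> \<mu> powr (1 - \<beta>) * \<mu> powr \<beta>"
    by (intro mult_right_mono) auto
  also have "\<dots> = \<mu>" using \<open>\<mu> > 0\<close> by (simp flip: powr_add)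
  finally show "A * \<mu> powr \<beta> / \<mu> \<le> 1 / 2"
    using \<open>\<mu> > 0\<close> by (simp add: field_simps)
qed

section \<open>Picard iteration\<close>

text \<open>The Lipschitz constant of \<open>x\<close> and the growth constant are fixed once,
  whereas the Lipschitz constant of \<open>f\<close> stays existential: existence and uniqueness
  apply it to different compact sets.\<close>

locale controlled_equation =
  fixes T0 T1 \<alpha> \<beta> L C :: real
    and x :: "real \<Rightarrow> real^'d"
    and w :: "real \<Rightarrow> real^'m"
    and f :: "real \<times> (real \<Rightarrow> real^'m) \<Rightarrow> (real^'d) \<Rightarrow>\<^sub>L (real^'m)"
  assumes T0: "0 \<le> T0" and T1: "T0 < T1"
    and \<beta>: "0 < \<beta>" and \<alpha>: "\<beta> < \<alpha>" "\<alpha> < 1"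
    and x_lipschitz: "L-lipschitz_on {0..T1} x"
    and initial: "(T0, stopped T1 T0 w) \<in> stopped_paths \<alpha> T1"
    and f_continuous: "continuous_map (stopped_topology \<alpha> \<beta> T1) euclidean f"
    and f_lipschitz: "\<And>K. compactin (holder_topology \<alpha> \<beta> T1) K \<Longrightarrow>
         (\<exists>L>0. \<forall>t\<in>{0..T1}. \<forall>u\<in>K. \<forall>v\<in>K.
            norm (f (t, stopped T1 t u) - f (t, stopped T1 t v))
              \<le> L * (norm (u 0 - v 0)
                   + holder_seminorm \<beta> T1 (\<lambda>r. stopped T1 t u r - stopped T1 t v r)))"
    and C: "0 < C"
    and f_growth: "\<And>t u. (t, u) \<in> stopped_paths \<alpha> T1 \<Longrightarrow>
         norm (f (t, u)) \<le> C * (1 + norm (u 0) + holder_seminorm \<beta> T1 u)"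
begin

section \<open>The solution map and its fixed points\<close>

abbreviation integrand :: "(real \<Rightarrow> real^'m) \<Rightarrow> real \<Rightarrow> (real^'d) \<Rightarrow>\<^sub>L (real^'m)" where
  "integrand y \<equiv> \<lambda>s. f (s, stopped T1 s y)"

text \<open>The initial path frozen at \<open>T0\<close>. It is this path, not \<open>w\<close>
  itself, that is known to be Hoelder continuous on all of \<open>[0,T1]\<close>; it seeds the
  iteration and is the centre of the invariant set.\<close>

definition start :: "real \<Rightarrow> real^'m" where
  "start = stopped T1 T0 w"

definition picard :: "(real \<Rightarrow> real^'m) \<Rightarrow> real \<Rightarrow> real^'m" where
  "picard y = (\<lambda>t\<in>{0..T1}. if t \<le> T0 then w t else w T0 + RS_integral_vec (integrand y) x T0 t)"

text \<open>The dimension enters because the integral is a sum over the coordinates of \<open>x\<close>, each of which is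
  \<open>L\<close>-Lipschitz.\<close>

definition speed :: real where
  "speed = real CARD('d) * L"

lemma T1_pos: "0 < T1"
  using T0 T1 by linarith

lemma speed_nonneg: "0 \<le> speed"
  using lipschitz_on_nonneg[OF x_lipschitz] by (simp add: speed_def)

lemma start_space: "start \<in> holder_space \<alpha> T1"
  using stopped_paths_subset[OF T1_pos _ initial] \<alpha> \<beta> by (simp add: start_def)

lemma start_0: "start 0 = w 0"
  using T0 T1 by (simp add: start_def stopped_def)

text \<open>The curve of stopped paths is continuous in the metric on which \<open>f\<close> is
  continuous; hence the integrals in the equation exist.\<close>

lemma continuous_on_integrand:
  assumes "y \<in> holder_space \<alpha> T1"
  shows "continuous_on {0..T1} (integrand y)"
  using continuous_map_compose[OF continuous_map_stopped[OF T1_pos \<beta> \<alpha>(1) assms] f_continuous]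
  by (simp add: o_def continuous_map_iff_continuous)

lemma x_lipschitz_subset: "0 \<le> a \<Longrightarrow> b \<le> T1 \<Longrightarrow> L-lipschitz_on {a..b} x"
  by (rule lipschitz_on_subset[OF x_lipschitz]) auto

text \<open>Additivity at three equal endpoints makes the value equal to twice itself.\<close>

lemma integral_degenerate:
  assumes "0 \<le> a" "a \<le> T1" "continuous_on {0..T1} G"
  shows "RS_integral_vec G x a a = 0"
  using RS_integral_vec_combine[OF x_lipschitz_subset[OF assms(1,2)]
      continuous_on_subset[OF assms(3)], of a] assms by auto

text \<open>The upper limit \<open>max T0 t\<close> merges the two branches: before
  \<open>T0\<close> the integral runs over a degenerate interval.\<close>

lemma picard_eq:
  assumes "y \<in> holder_space \<alpha> T1" "t \<in> {0..T1}"
  shows "picard y t = start t + RS_integral_vec (integrand y) x T0 (max T0 t)"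
  using assms T0 T1 integral_degenerate[OF T0 _ continuous_on_integrand[OF assms(1)]]
  by (auto simp: picard_def start_def stopped_def max_def min_def)

lemma picard_0: "picard y 0 = w 0"
  using T0 T1 by (simp add: picard_def)

text \<open>Subtracting \<open>start\<close>, known only to be Hoelder continuous, leaves the
  integral, whose increments admit exponentially weighted bounds.\<close>

lemma picard_increment:
  assumes y: "y \<in> holder_space \<alpha> T1" and st: "0 \<le> s" "s \<le> t" "t \<le> T1"
  shows "(picard y t - start t) - (picard y s - start s)
    = RS_integral_vec (integrand y) x (max T0 s) (max T0 t)"
proof -
  have "RS_integral_vec (integrand y) x T0 (max T0 t) =
      RS_integral_vec (integrand y) x T0 (max T0 s) + RS_integral_vec (integrand y) x (max T0 s) (max T0 t)"
    using st T0 T1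
    by (intro RS_integral_vec_combine[OF x_lipschitz_subset continuous_on_subset[OF continuous_on_integrand[OF y]]]) auto
  then show ?thesis
    using picard_eq[OF y, of s] picard_eq[OF y, of t] st by simp
qed

lemma norm_integral_le_exp:
  assumes G: "continuous_on {0..T1} G" and "0 < \<mu>"
    and bound: "\<And>r. r \<in> {0..T1} \<Longrightarrow> speed * norm (G r) \<le> c * exp (\<mu> * r)"
    and st: "0 \<le> s" "s \<le> t" "t \<le> T1"
  shows "norm (RS_integral_vec G x (max T0 s) (max T0 t)) \<le> c / \<mu> * (exp (\<mu> * t) - exp (\<mu> * s))"
proof -
  have "norm (RS_integral_vec G x (max T0 s) (max T0 t))
      \<le> c / \<mu> * (exp (\<mu> * max T0 t) - exp (\<mu> * max T0 s))"
  proof (rule norm_RS_integral_vec_le[OF x_lipschitz_subset])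
    show "continuous_on {max T0 s..max T0 t} G"
      by (rule continuous_on_subset[OF G]) (use T0 T1 st in auto)
    show "((\<lambda>r. c * exp (\<mu> * r)) has_integral c / \<mu> * (exp (\<mu> * max T0 t) - exp (\<mu> * max T0 s)))
        {max T0 s..max T0 t}"
      by (rule has_integral_exp_scaled) (use st \<open>0 < \<mu>\<close> in auto)
    show "real CARD('d) * L * norm (G r) \<le> c * exp (\<mu> * r)" if "r \<in> {max T0 s..max T0 t}" for r
      using bound[of r] that T0 T1 st by (auto simp: speed_def max_def split: if_splits)
  qed (use T0 T1 st in auto)
  also have "\<dots> \<le> c / \<mu> * (exp (\<mu> * t) - exp (\<mu> * s))"
  proof (rule mult_left_mono)
    \<comment> \<open>The clamped interval either lies in \<open>[s,t]\<close> or is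
      degenerate.\<close>
    show "exp (\<mu> * max T0 t) - exp (\<mu> * max T0 s) \<le> exp (\<mu> * t) - exp (\<mu> * s)"
      using st \<open>0 < \<mu>\<close> by (auto simp: max_def)
    \<comment> \<open>The sign of \<open>c\<close> is read off from the bound at time
      \<open>0\<close>.\<close>
    have "0 \<le> speed * norm (G 0)" using speed_nonneg by simp
    also have "\<dots> \<le> c" using bound[of 0] T1_pos by simp
    finally show "0 \<le> c / \<mu>" using \<open>0 < \<mu>\<close> by simp
  qed
  finally show ?thesis .
qed

lemma exp_lipschitz_picard:
  assumes y: "y \<in> holder_space \<alpha> T1" and "0 < \<mu>"
    and bound: "\<And>r. r \<in> {0..T1} \<Longrightarrow> speed * norm (integrand y r) \<le> c * exp (\<mu> * r)"
  shows "exp_lipschitz \<mu> T1 (c / \<mu>) (\<lambda>t. picard y t - start t)"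
  by (rule exp_lipschitzI)
    (use picard_increment[OF y] norm_integral_le_exp[OF continuous_on_integrand[OF y] \<open>0 < \<mu>\<close> bound] in simp)

lemma exp_lipschitz_picard_diff:
  assumes u: "u \<in> holder_space \<alpha> T1" and v: "v \<in> holder_space \<alpha> T1" and "0 < \<mu>"
    and bound: "\<And>r. r \<in> {0..T1} \<Longrightarrow> speed * norm (integrand u r - integrand v r) \<le> c * exp (\<mu> * r)"
  shows "exp_lipschitz \<mu> T1 (c / \<mu>) (\<lambda>t. picard u t - picard v t)"
proof (rule exp_lipschitzI)
  fix s t assume st: "0 \<le> s" "s \<le> t" "t \<le> T1"
  have sub: "{max T0 s..max T0 t} \<subseteq> {0..T1}" using T0 T1 st by auto
  note cont = continuous_on_integrand[OF u] continuous_on_integrand[OF v]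
  have "(picard u t - picard v t) - (picard u s - picard v s)
      = ((picard u t - start t) - (picard u s - start s)) - ((picard v t - start t) - (picard v s - start s))"
    by simp
  also have "\<dots> = RS_integral_vec (integrand u) x (max T0 s) (max T0 t)
      - RS_integral_vec (integrand v) x (max T0 s) (max T0 t)"
    unfolding picard_increment[OF u st] picard_increment[OF v st] ..
  also have "\<dots> = RS_integral_vec (\<lambda>r. integrand u r - integrand v r) x (max T0 s) (max T0 t)"
    using T0 T1 st by (intro RS_integral_vec_diff[symmetric, OF x_lipschitz_subset]
        continuous_on_subset[OF cont(1) sub] continuous_on_subset[OF cont(2) sub]) auto
  finally show "norm ((picard u t - picard v t) - (picard u s - picard v s))
      \<le> c / \<mu> * (exp (\<mu> * t) - exp (\<mu> * s))"
    using norm_integral_le_exp[OF continuous_on_diff[OF cont] \<open>0 < \<mu>\<close> bound st] by simp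
qed

text \<open>The integrability clause follows from continuity of the integrand along a Hoelder path,
  and at \<open>T0\<close> both branches agree because the integral there vanishes.\<close>

lemma solution_iff:
  "is_CDE_solution \<alpha> T0 T1 f x w T1 y \<longleftrightarrow> y \<in> holder_space \<alpha> T1 \<and> picard y = y"
proof safe
  assume sol: "is_CDE_solution \<alpha> T0 T1 f x w T1 y"
  then show y: "y \<in> holder_space \<alpha> T1" by (simp add: is_CDE_solution_def)
  show "picard y = y"
  proof (rule extensionalityI[of _ "{0..T1}"])
    show "picard y \<in> extensional {0..T1}" by (simp add: picard_def)
    show "y \<in> extensional {0..T1}" using y by (simp add: holder_space_def)
    show "picard y t = y t" if "t \<in> {0..T1}" for t
      using sol that by (auto simp: is_CDE_solution_def picard_def)
  qed
next
  assume y: "y \<in> holder_space \<alpha> T1" and fixed: "picard y = y"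
  show "is_CDE_solution \<alpha> T0 T1 f x w T1 y"
    unfolding is_CDE_solution_def
  proof (intro conjI ballI impI)
    show "y t = w t" if "t \<in> {0..T1}" "t \<le> T0" for t
      using fun_cong[OF fixed, of t] that by (simp add: picard_def)
    fix t assume t: "t \<in> {0..T1}" "T0 \<le> t"
    show "RS_integrable_vec (integrand y) x T0 t"
      using t T0 by (intro RS_integrable_vec_continuous[OF x_lipschitz_subset]
          continuous_on_subset[OF continuous_on_integrand[OF y]]) auto
    have "start t = w T0" using t T0 by (simp add: start_def stopped_def min_def)
    then show "y t = w T0 + RS_integral_vec (integrand y) x T0 t"
      using fun_cong[OF fixed, of t] picard_eq[OF y t(1)] t by (simp add: max_def)
  qed (rule y)
qed

text \<open>Compactness of the ball provides one Lipschitz constant \<open>K\<close>. The stopped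
  difference has \<beta>-seminorm at most
  \<open>\<rho> * exp (\<mu> * r) * \<mu> powr \<beta>\<close> and integration divides by
  \<open>\<mu>\<close>, so the new constant is
  \<open>speed * K * \<rho> * \<mu> powr \<beta> / \<mu>\<close>. The threshold
  \<open>\<mu>\<^sub>0\<close> depends on the ball but not on \<open>\<rho>\<close>,
  \<open>u\<close> or \<open>v\<close>, so the estimate can be iterated.\<close>

lemma picard_contraction:
  assumes "0 \<le> M"
  obtains \<mu>\<^sub>0 where "\<mu>\<^sub>0 > 0"
    "\<And>\<mu> \<rho> u v. \<lbrakk>\<mu> \<ge> \<mu>\<^sub>0; 0 \<le> \<rho>; u \<in> holder_ball \<alpha> T1 B M; v \<in> holder_ball \<alpha> T1 B M; u 0 = v 0;
        exp_lipschitz \<mu> T1 \<rho> (\<lambda>t. u t - v t)\<rbrakk>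
      \<Longrightarrow> exp_lipschitz \<mu> T1 (\<rho> / 2) (\<lambda>t. picard u t - picard v t)"
proof -
  obtain K where "K > 0" and K: "\<And>t u v. \<lbrakk>t \<in> {0..T1}; u \<in> holder_ball \<alpha> T1 B M; v \<in> holder_ball \<alpha> T1 B M\<rbrakk>
      \<Longrightarrow> norm (integrand u t - integrand v t) \<le> K * (norm (u 0 - v 0)
                   + holder_seminorm \<beta> T1 (\<lambda>r. stopped T1 t u r - stopped T1 t v r))"
    using f_lipschitz[OF compactin_holder_ball[OF T1_pos \<beta> \<alpha>(1) assms]] by meson
  have "0 \<le> speed * K" using speed_nonneg \<open>K > 0\<close> by simp
  then obtain \<mu>\<^sub>0 where "\<mu>\<^sub>0 > 0" and \<mu>\<^sub>0: "\<And>\<mu>. \<mu> \<ge> \<mu>\<^sub>0 \<Longrightarrow> speed * K * \<mu> powr \<beta> / \<mu> \<le> 1 / 2"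
    using powr_div_eventually_le[of "speed * K" \<beta>] \<alpha> by auto
  show thesis
  proof (rule that[OF \<open>\<mu>\<^sub>0 > 0\<close>])
    fix \<mu> \<rho> and u v :: "real \<Rightarrow> real^'m"
    assume \<mu>: "\<mu> \<ge> \<mu>\<^sub>0" and \<rho>: "0 \<le> \<rho>" and u: "u \<in> holder_ball \<alpha> T1 B M" and v: "v \<in> holder_ball \<alpha> T1 B M"
      and "u 0 = v 0" and uv: "exp_lipschitz \<mu> T1 \<rho> (\<lambda>t. u t - v t)"
    have "\<mu> > 0" using \<mu> \<open>\<mu>\<^sub>0 > 0\<close> by linarith
    have bound: "speed * norm (integrand u r - integrand v r) \<le> speed * K * \<rho> * \<mu> powr \<beta> * exp (\<mu> * r)"
      if r: "r \<in> {0..T1}" for r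
    proof -
      have "holder_seminorm \<beta> T1 (\<lambda>q. stopped T1 r u q - stopped T1 r v q) \<le> \<rho> * exp (\<mu> * r) * \<mu> powr \<beta>"
      proof (rule holder_seminorm_stopped_le[OF T1_pos])
        show "norm (u t - v t - (u s - v s)) \<le> \<rho> * exp (\<mu> * r) * \<mu> powr \<beta> * (t - s) powr \<beta>"
          if "0 \<le> s" "s < t" "t \<le> r" "t \<le> T1" for s t
          using that \<alpha> \<beta> \<open>\<mu> > 0\<close> by (intro exp_lipschitz_holder[OF uv \<rho>]) auto
      qed (use \<beta> \<rho> r in \<open>auto simp: stopped_def\<close>)
      then have "K * holder_seminorm \<beta> T1 (\<lambda>q. stopped T1 r u q - stopped T1 r v q)
          \<le> K * (\<rho> * exp (\<mu> * r) * \<mu> powr \<beta>)"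
        using \<open>K > 0\<close> by (intro mult_left_mono) auto
      then have "norm (integrand u r - integrand v r) \<le> K * (\<rho> * exp (\<mu> * r) * \<mu> powr \<beta>)"
        using K[OF r u v] \<open>u 0 = v 0\<close> by simp
      from mult_left_mono[OF this speed_nonneg] show ?thesis
        by (simp add: ac_simps)
    qed
    have "exp_lipschitz \<mu> T1 (speed * K * \<rho> * \<mu> powr \<beta> / \<mu>) (\<lambda>t. picard u t - picard v t)"
      using u v holder_ball_subset[OF T1_pos] by (intro exp_lipschitz_picard_diff[OF _ _ \<open>\<mu> > 0\<close> bound]) auto
    moreover have "speed * K * \<rho> * \<mu> powr \<beta> / \<mu> \<le> \<rho> / 2"
      using mult_left_mono[OF \<mu>\<^sub>0[OF \<mu>] \<rho>] by (simp add: ac_simps)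
    ultimately show "exp_lipschitz \<mu> T1 (\<rho> / 2) (\<lambda>t. picard u t - picard v t)"
      using \<open>\<mu> > 0\<close> by (auto intro: exp_lipschitz_mono)
  qed
qed

text \<open>Split \<open>y\<close> into \<open>start\<close> and the deviation from it. The case
  \<open>\<gamma> = \<beta>\<close> feeds the growth bound, the case
  \<open>\<gamma> = \<alpha>\<close> the compact ball.\<close>

lemma increment_near_start:
  assumes "exp_lipschitz \<kappa> T1 R (\<lambda>t. y t - start t)" "0 \<le> R" "0 < \<kappa>" "0 \<le> \<gamma>" "\<gamma> \<le> \<alpha>"
    and "0 \<le> s" "s < t" "t \<le> \<tau>" "t \<le> T1"
  shows "norm (y t - y s) \<le> (holder_seminorm \<gamma> T1 start + R * exp (\<kappa> * \<tau>) * \<kappa> powr \<gamma>) * (t - s) powr \<gamma>"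
proof -
  have "bdd_above (holder_quotients \<gamma> T1 start)"
    using start_space assms(5) T1_pos holder_bdd_mono by (auto simp: holder_space_def)
  then have "norm (start t - start s) \<le> holder_seminorm \<gamma> T1 start * (t - s) powr \<gamma>"
    using assms by (intro holder_seminorm_bound) auto
  moreover have "norm ((y t - start t) - (y s - start s)) \<le> R * exp (\<kappa> * \<tau>) * \<kappa> powr \<gamma> * (t - s) powr \<gamma>"
    using assms \<alpha> by (intro exp_lipschitz_holder[OF assms(1)]) auto
  ultimately have "norm ((start t - start s) + ((y t - start t) - (y s - start s)))
      \<le> holder_seminorm \<gamma> T1 start * (t - s) powr \<gamma> + R * exp (\<kappa> * \<tau>) * \<kappa> powr \<gamma> * (t - s) powr \<gamma>"
    by (rule norm_triangle_mono)
  then show ?thesis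
    by (simp add: distrib_right)
qed

text \<open>Places the whole invariant set inside one compact ball, fixed before the contraction
  rate is chosen.\<close>

lemma near_start_in_ball:
  assumes "y \<in> extensional {0..T1}" "y 0 = w 0"
    and "exp_lipschitz \<kappa> T1 R (\<lambda>t. y t - start t)" "0 \<le> R" "0 < \<kappa>"
  shows "y \<in> holder_ball \<alpha> T1 (norm (w 0)) (holder_seminorm \<alpha> T1 start + R * exp (\<kappa> * T1) * \<kappa> powr \<alpha>)"
  using assms(1,2) increment_near_start[OF assms(3-5), of \<alpha> _ _ T1] \<alpha> \<beta>
  by (auto simp: holder_ball_def)

text \<open>Under linear growth, the contribution of \<open>R\<close> to the new radius is
  \<open>A * R * \<kappa> powr \<beta> / \<kappa>\<close>, at most \<open>R / 2\<close> once
  \<open>\<kappa>\<close> is large. The choice of \<open>\<kappa>\<close> does not involve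
  \<open>R\<close>, so \<open>R\<close> can still be taken large enough for the remaining
  terms.\<close>

lemma picard_invariant:
  obtains \<kappa> R where "0 < \<kappa>" "0 \<le> R"
    "\<And>y. \<lbrakk>y \<in> extensional {0..T1}; y 0 = w 0; exp_lipschitz \<kappa> T1 R (\<lambda>t. y t - start t)\<rbrakk>
      \<Longrightarrow> exp_lipschitz \<kappa> T1 R (\<lambda>t. picard y t - start t)"
proof -
  define A where "A = speed * C"
  define Z where "Z = 1 + norm (w 0) + holder_seminorm \<beta> T1 start"
  have "0 \<le> A" using speed_nonneg C by (simp add: A_def)
  have "0 \<le> Z" using holder_seminorm_nonneg[OF T1_pos, of \<beta> start] norm_ge_zero[of "w 0"]
    unfolding Z_def by linarith
  have "\<beta> < 1" using \<alpha> by simp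
  obtain \<kappa> where "\<kappa> > 0" and "\<And>\<mu>. \<mu> \<ge> \<kappa> \<Longrightarrow> A * \<mu> powr \<beta> / \<mu> \<le> 1 / 2"
    using powr_div_eventually_le[OF \<open>0 \<le> A\<close> \<open>\<beta> < 1\<close>] by blast
  then have \<kappa>: "A * \<kappa> powr \<beta> / \<kappa> \<le> 1 / 2" by blast
  \<comment> \<open>\<open>Z\<close> collects the part of the growth bound coming from
    \<open>start\<close>; its contribution \<open>A * Z / \<kappa>\<close> is then exactly
    \<open>R / 2\<close>.\<close>
  define R where "R = 2 * A * Z / \<kappa>"
  have "0 \<le> R" using \<open>0 \<le> A\<close> \<open>0 \<le> Z\<close> \<open>\<kappa> > 0\<close> by (simp add: R_def)
  show thesis
  proof (rule that[OF \<open>\<kappa> > 0\<close> \<open>0 \<le> R\<close>])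
    fix y assume y: "y \<in> extensional {0..T1}" "y 0 = w 0" "exp_lipschitz \<kappa> T1 R (\<lambda>t. y t - start t)"
    have space: "y \<in> holder_space \<alpha> T1"
      using near_start_in_ball[OF y \<open>0 \<le> R\<close> \<open>\<kappa> > 0\<close>] holder_ball_subset[OF T1_pos] by blast
    have "speed * norm (integrand y r) \<le> (A * Z + A * R * \<kappa> powr \<beta>) * exp (\<kappa> * r)"
      if r: "r \<in> {0..T1}" for r
    proof -
      have "holder_seminorm \<beta> T1 (stopped T1 r y)
          \<le> holder_seminorm \<beta> T1 start + R * exp (\<kappa> * r) * \<kappa> powr \<beta>"
      proof (rule holder_seminorm_stopped_le[OF T1_pos])
        show "0 \<le> holder_seminorm \<beta> T1 start + R * exp (\<kappa> * r) * \<kappa> powr \<beta>"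
          using holder_seminorm_nonneg[OF T1_pos, of \<beta> start] \<open>0 \<le> R\<close> by (intro add_nonneg_nonneg) auto
        show "norm (y t - y s) \<le> (holder_seminorm \<beta> T1 start + R * exp (\<kappa> * r) * \<kappa> powr \<beta>) * (t - s) powr \<beta>"
          if "0 \<le> s" "s < t" "t \<le> r" "t \<le> T1" for s t
          using that \<alpha> \<beta> by (intro increment_near_start[OF y(3) \<open>0 \<le> R\<close> \<open>\<kappa> > 0\<close>]) auto
      qed (use \<beta> r in \<open>auto simp: stopped_def\<close>)
      moreover have "norm (integrand y r)
          \<le> C * (1 + norm (stopped T1 r y 0) + holder_seminorm \<beta> T1 (stopped T1 r y))"
        using r space by (intro f_growth) (auto simp: stopped_paths_def)
      moreover have "stopped T1 r y 0 = w 0"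
        using r y(2) by (simp add: stopped_def)
      ultimately have "norm (integrand y r) \<le> C * (1 + norm (w 0) + holder_seminorm \<beta> T1 (stopped T1 r y))"
        and "1 + norm (w 0) + holder_seminorm \<beta> T1 (stopped T1 r y) \<le> Z + R * exp (\<kappa> * r) * \<kappa> powr \<beta>"
        by (simp_all add: Z_def)
      then have "norm (integrand y r) \<le> C * (Z + R * exp (\<kappa> * r) * \<kappa> powr \<beta>)"
        using mult_left_mono[OF _ less_imp_le[OF C]] order_trans by blast
      from mult_left_mono[OF this speed_nonneg]
      have "speed * norm (integrand y r) \<le> A * Z * 1 + A * R * \<kappa> powr \<beta> * exp (\<kappa> * r)"
        by (simp add: A_def algebra_simps)
      also have "\<dots> \<le> A * Z * exp (\<kappa> * r) + A * R * \<kappa> powr \<beta> * exp (\<kappa> * r)"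
        using r \<open>\<kappa> > 0\<close> \<open>0 \<le> A\<close> \<open>0 \<le> Z\<close> by (intro add_right_mono mult_left_mono) auto
      finally show ?thesis by (simp add: algebra_simps)
    qed
    from exp_lipschitz_picard[OF space \<open>\<kappa> > 0\<close> this]
    have "exp_lipschitz \<kappa> T1 ((A * Z + A * R * \<kappa> powr \<beta>) / \<kappa>) (\<lambda>t. picard y t - start t)" .
    moreover have "(A * Z + A * R * \<kappa> powr \<beta>) / \<kappa> \<le> R"
    proof -
      have "A * Z / \<kappa> = R / 2" by (simp add: R_def)
      moreover have "A * R * \<kappa> powr \<beta> / \<kappa> \<le> R / 2"
        using mult_left_mono[OF \<kappa> \<open>0 \<le> R\<close>] by (simp add: ac_simps)
      ultimately show ?thesis unfolding add_divide_distrib by linarith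
    qed
    ultimately show "exp_lipschitz \<kappa> T1 R (\<lambda>t. picard y t - start t)"
      using \<open>\<kappa> > 0\<close> by (auto intro: exp_lipschitz_mono)
  qed
qed

text \<open>The iterates from \<open>start\<close> stay in the invariant set, so the contraction
  applies to all of them and to their limit; comparing the limit with its image along the iterates
  shows that it is fixed.\<close>

lemma picard_fixed_point_exists: "\<exists>y \<in> holder_space \<alpha> T1. picard y = y"
proof -
  obtain \<kappa> R where \<kappa>: "0 < \<kappa>" and R: "0 \<le> R" and
    inv: "\<And>y. \<lbrakk>y \<in> extensional {0..T1}; y 0 = w 0; exp_lipschitz \<kappa> T1 R (\<lambda>t. y t - start t)\<rbrakk>
      \<Longrightarrow> exp_lipschitz \<kappa> T1 R (\<lambda>t. picard y t - start t)"
    by (rule picard_invariant) (rule that; assumption)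
  define M where "M = holder_seminorm \<alpha> T1 start + R * exp (\<kappa> * T1) * \<kappa> powr \<alpha>"
  have "0 \<le> M" using holder_seminorm_nonneg[OF T1_pos, of \<alpha> start] R unfolding M_def
    by (intro add_nonneg_nonneg) auto
  obtain \<mu>\<^sub>0 where contr: "\<And>\<mu> \<rho> u v. \<lbrakk>\<mu> \<ge> \<mu>\<^sub>0; 0 \<le> \<rho>; u \<in> holder_ball \<alpha> T1 (norm (w 0)) M;
        v \<in> holder_ball \<alpha> T1 (norm (w 0)) M; u 0 = v 0; exp_lipschitz \<mu> T1 \<rho> (\<lambda>t. u t - v t)\<rbrakk>
      \<Longrightarrow> exp_lipschitz \<mu> T1 (\<rho> / 2) (\<lambda>t. picard u t - picard v t)"
    by (rule picard_contraction[OF \<open>0 \<le> M\<close>, of "norm (w 0)"]) (rule that; assumption)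
  \<comment> \<open>Two rates are needed: \<open>\<kappa>\<close> determines the ball, and
    \<open>\<mu>\<^sub>0\<close> depends on that ball.\<close>
  define \<mu> where "\<mu> = max \<kappa> \<mu>\<^sub>0"
  have \<mu>: "\<mu> \<ge> \<mu>\<^sub>0" "\<mu> \<ge> \<kappa>" "\<mu> > 0" using \<kappa> by (auto simp: \<mu>_def)
  define Y where "Y = (\<lambda>n. (picard ^^ n) start)"
  have Y_Suc: "Y (Suc n) = picard (Y n)" for n by (simp add: Y_def)
  have Y: "Y n \<in> extensional {0..T1} \<and> Y n 0 = w 0 \<and> exp_lipschitz \<kappa> T1 R (\<lambda>t. Y n t - start t)" for n
  proof (induction n)
    case 0
    have "exp_lipschitz \<kappa> T1 R (\<lambda>t. start t - start t)"
      using \<kappa> R by (intro exp_lipschitzI) (auto intro!: mult_nonneg_nonneg mult_left_mono)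
    then show ?case
      using start_space start_0 by (simp add: Y_def holder_space_def)
  next
    case (Suc n)
    then show ?case
      using inv[of "Y n"] picard_0 by (simp add: Y_Suc) (simp add: picard_def)
  qed
  have Y_ball: "Y n \<in> holder_ball \<alpha> T1 (norm (w 0)) M" for n
    unfolding M_def using near_start_in_ball[OF _ _ _ R \<kappa>] Y by blast
  have step: "exp_lipschitz \<mu> T1 (R / 2 ^ n) (\<lambda>t. Y (Suc n) t - Y n t)" for n
  proof (induction n)
    case 0
    \<comment> \<open>\<open>Y 0\<close> is \<open>start\<close>, so invariance bounds the first
      step at rate \<open>\<kappa>\<close>; passing to a larger rate only weakens the bound.\<close>
    have "exp_lipschitz \<kappa> T1 R (\<lambda>t. Y 1 t - Y 0 t)" using Y[of 1] by (simp add: Y_def)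
    then show ?case
      using exp_diff_mono[of \<kappa> \<mu>] \<kappa> \<mu> R
      by (auto simp: exp_lipschitz_def intro!: order_trans[OF _ mult_left_mono[OF exp_diff_mono[of \<kappa> \<mu>] R]])
  next
    case (Suc n)
    have "exp_lipschitz \<mu> T1 (R / 2 ^ n / 2) (\<lambda>t. picard (Y (Suc n)) t - picard (Y n) t)"
      using R Y by (intro contr[OF \<mu>(1) _ Y_ball Y_ball _ Suc.IH]) auto
    then show ?case by (simp add: Y_Suc ac_simps)
  qed
  have Y_0: "Y n 0 = w 0" for n using Y by blast
  obtain y where y: "y \<in> extensional {0..T1}"
    and lim: "\<And>t. t \<in> {0..T1} \<Longrightarrow> (\<lambda>n. Y n t) \<longlonglongrightarrow> y t"
    and dist: "\<And>n. exp_lipschitz \<mu> T1 (2 * R / 2 ^ n) (\<lambda>t. y t - Y n t)"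
    using exp_lipschitz_geometric_limit[OF step Y_0 R less_imp_le[OF \<mu>(3)]] by blast
  have y0: "y 0 = w 0"
    using LIMSEQ_unique[OF lim[of 0], of "w 0"] Y T1_pos by simp
  \<comment> \<open>The rate \<open>\<kappa>\<close> is kept here so that the limit lies in the same
    ball as the iterates and the contraction applies to it.\<close>
  have "exp_lipschitz \<kappa> T1 R (\<lambda>t. y t - start t)"
    by (rule exp_lipschitz_LIMSEQ[where u = "\<lambda>n t. Y n t - start t"])
      (use Y in \<open>auto intro!: tendsto_intros lim\<close>)
  then have y_ball: "y \<in> holder_ball \<alpha> T1 (norm (w 0)) M"
    unfolding M_def by (intro near_start_in_ball y y0 R \<kappa>)
  have "picard y t = y t" if "t \<in> {0..T1}" for t
  proof -
    \<comment> \<open>Passing through \<open>Y (Suc n) = picard (Y n)\<close> leaves two errors of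
      \<open>R / 2 ^ n\<close>: one from the contraction, one from the convergence.\<close>
    have "exp_lipschitz \<mu> T1 (2 * R / 2 ^ n) (\<lambda>t. picard y t - y t)" for n
    proof -
      have "exp_lipschitz \<mu> T1 (2 * R / 2 ^ n / 2) (\<lambda>t. picard y t - picard (Y n) t)"
        using R Y y0 by (intro contr[OF \<mu>(1) _ y_ball Y_ball _ dist]) auto
      moreover have "exp_lipschitz \<mu> T1 (2 * R / 2 ^ Suc n) (\<lambda>t. Y (Suc n) t - y t)"
        using dist[of "Suc n"] exp_lipschitz_minus_commute by blast
      ultimately have "exp_lipschitz \<mu> T1 (2 * R / 2 ^ n / 2 + 2 * R / 2 ^ Suc n)
          (\<lambda>t. (picard y t - picard (Y n) t) + (Y (Suc n) t - y t))"
        by (rule exp_lipschitz_add)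
      moreover have "2 * R / 2 ^ n / 2 + 2 * R / 2 ^ Suc n = 2 * R / 2 ^ n" by simp
      ultimately show ?thesis by (simp only: Y_Suc diff_add_cancel add_diff_eq)
    qed
    then show ?thesis
      using exp_lipschitz_eq_zero[of \<mu> T1 "2 * R" "\<lambda>t. picard y t - y t" t] that picard_0 y0 by simp
  qed
  then have "picard y = y"
    using y by (intro extensionalityI[of _ "{0..T1}"]) (auto simp: picard_def)
  then show ?thesis
    using y_ball holder_ball_subset[OF T1_pos] by blast
qed

text \<open>The larger of the two \<alpha>-seminorms defines a ball containing both fixed points.
  Their difference equals the difference of their images, so any finite weighted bound on it can be
  halved indefinitely.\<close>

lemma picard_fixed_point_unique:
  assumes y: "y \<in> holder_space \<alpha> T1" "picard y = y" and z: "z \<in> holder_space \<alpha> T1" "picard z = z"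
  shows "y = z"
proof -
  have init: "y 0 = w 0" "z 0 = w 0" using picard_0 y(2) z(2) by metis+
  define M where "M = max (holder_seminorm \<alpha> T1 y) (holder_seminorm \<alpha> T1 z)"
  have "0 \<le> M" using holder_seminorm_nonneg[OF T1_pos, of \<alpha> y] by (simp add: M_def)
  have ball: "y \<in> holder_ball \<alpha> T1 (norm (w 0)) M" "z \<in> holder_ball \<alpha> T1 (norm (w 0)) M"
    using y z init by (auto intro!: holder_space_in_ball simp: M_def)
  obtain \<mu> where "\<mu> > 0" and contraction: "\<And>\<mu>' \<rho> u v. \<lbrakk>\<mu>' \<ge> \<mu>; 0 \<le> \<rho>; u \<in> holder_ball \<alpha> T1 (norm (w 0)) M;
        v \<in> holder_ball \<alpha> T1 (norm (w 0)) M; u 0 = v 0; exp_lipschitz \<mu>' T1 \<rho> (\<lambda>t. u t - v t)\<rbrakk>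
      \<Longrightarrow> exp_lipschitz \<mu>' T1 (\<rho> / 2) (\<lambda>t. picard u t - picard v t)"
    by (rule picard_contraction[OF \<open>0 \<le> M\<close>, of "norm (w 0)"]) (rule that; assumption)
  have contr: "exp_lipschitz \<mu> T1 (\<rho> / 2) (\<lambda>t. y t - z t)"
    if "0 \<le> \<rho>" "exp_lipschitz \<mu> T1 \<rho> (\<lambda>t. y t - z t)" for \<rho>
    using contraction[OF order_refl that(1) ball _ that(2)] init by (simp add: y(2) z(2))
  \<comment> \<open>The halving needs a finite constant to start from: the integrands differ by a
    bounded amount on the compact interval, and integration gives \<open>c / \<mu>\<close>.\<close>
  have "continuous_on {0..T1} (\<lambda>r. integrand y r - integrand z r)"
    using y(1) z(1) by (intro continuous_on_diff continuous_on_integrand)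
  then have "bounded ((\<lambda>r. integrand y r - integrand z r) ` {0..T1})"
    by (intro compact_imp_bounded compact_continuous_image) auto
  then obtain D where "\<forall>r\<in>{0..T1}. norm (integrand y r - integrand z r) \<le> D"
    unfolding bounded_iff by auto
  then have D: "norm (integrand y r - integrand z r) \<le> D" if "r \<in> {0..T1}" for r
    using that by blast
  have "0 \<le> D" using order_trans[OF norm_ge_zero D[of 0]] T1_pos by simp
  define c where "c = speed * D"
  have "0 \<le> c" using speed_nonneg \<open>0 \<le> D\<close> by (simp add: c_def)
  have "speed * norm (integrand y r - integrand z r) \<le> c * exp (\<mu> * r)" if r: "r \<in> {0..T1}" for r
  proof -
    have "speed * norm (integrand y r - integrand z r) \<le> c * 1"
      using D[OF r] speed_nonneg by (simp add: c_def mult_left_mono)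
    also have "\<dots> \<le> c * exp (\<mu> * r)"
      using r \<open>0 \<le> c\<close> \<open>\<mu> > 0\<close> by (intro mult_left_mono) auto
    finally show ?thesis .
  qed
  from exp_lipschitz_picard_diff[OF y(1) z(1) \<open>\<mu> > 0\<close> this]
  have first: "exp_lipschitz \<mu> T1 (c / \<mu>) (\<lambda>t. y t - z t)"
    by (simp add: y(2) z(2))
  have "exp_lipschitz \<mu> T1 (c / \<mu> / 2 ^ n) (\<lambda>t. y t - z t)" for n
  proof (induction n)
    case (Suc n)
    have "0 \<le> c / \<mu> / 2 ^ n" using \<open>0 \<le> c\<close> \<open>\<mu> > 0\<close> by simp
    from contr[OF this Suc.IH] show ?case by (simp add: ac_simps)
  qed (use first in simp)
  then have "y t - z t = 0" if "t \<in> {0..T1}" for t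
    using exp_lipschitz_eq_zero[of \<mu> T1 "c / \<mu>" "\<lambda>t. y t - z t" t] that init by simp
  then show "y = z"
    using y(1) z(1) by (intro extensionalityI[of _ "{0..T1}"]) (auto simp: holder_space_def)
qed

theorem unique_solution: "\<exists>!y. is_CDE_solution \<alpha> T0 T1 f x w T1 y"
  unfolding solution_iff using picard_fixed_point_exists picard_fixed_point_unique by blast

end

section \<open>Global well-posedness under Lipschitz bounds on compact sets and linear
  growth\<close>

theorem theorem3p1:
  fixes T\<^sub>0 T\<^sub>1 \<alpha> \<beta> :: real
    and x :: "real \<Rightarrow> real^'d"
    and w :: "real \<Rightarrow> real^'m"
    and f :: "real \<times> (real \<Rightarrow> real^'m) \<Rightarrow> (real^'d) \<Rightarrow>\<^sub>L (real^'m)"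
  assumes "T\<^sub>1 > 0" and "T\<^sub>0 \<in> {0..<T\<^sub>1}"
    and "\<alpha> \<in> {1/2<..<1}" and "\<beta> \<in> {0<..<\<alpha>}"
    and x_lipschitz: "\<exists>L. lipschitz_on L {0..T\<^sub>1} x"
    and initial: "(T\<^sub>0, stopped T\<^sub>1 T\<^sub>0 w) \<in> stopped_paths \<alpha> T\<^sub>1"
    and f_continuous: "continuous_map (stopped_topology \<alpha> \<beta> T\<^sub>1) euclidean f"
    and f_lipschitz:
      "\<forall>K. compactin (holder_topology \<alpha> \<beta> T\<^sub>1) K \<longrightarrow>
         (\<exists>L>0. \<forall>t\<in>{0..T\<^sub>1}. \<forall>u\<in>K. \<forall>v\<in>K.
            norm (f (t, stopped T\<^sub>1 t u) - f (t, stopped T\<^sub>1 t v))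
              \<le> L * (norm (u 0 - v 0)
                   + holder_seminorm \<beta> T\<^sub>1 (\<lambda>r. stopped T\<^sub>1 t u r - stopped T\<^sub>1 t v r)))"
    and f_growth:
      "\<exists>C>0. \<forall>(t, u)\<in>stopped_paths \<alpha> T\<^sub>1.
         norm (f (t, u)) \<le> C * (1 + norm (u 0) + holder_seminorm \<beta> T\<^sub>1 u)"
  shows "\<exists>!y. is_CDE_solution \<alpha> T\<^sub>0 T\<^sub>1 f x w T\<^sub>1 y"
proof -
  obtain L where L: "L-lipschitz_on {0..T\<^sub>1} x" using x_lipschitz by blast
  obtain C where C: "C > 0" "\<And>t u. (t, u) \<in> stopped_paths \<alpha> T\<^sub>1 \<Longrightarrow>
      norm (f (t, u)) \<le> C * (1 + norm (u 0) + holder_seminorm \<beta> T\<^sub>1 u)"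
    using f_growth by blast
  interpret controlled_equation T\<^sub>0 T\<^sub>1 \<alpha> \<beta> L C x w f
    using assms(2-4) L initial f_continuous f_lipschitz C by unfold_locales auto
  show ?thesis by (rule unique_solution)
qed

end
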